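(* Suppose that $\varphi$ is an analytic self-map of the unit disk $D$ and $0<p<\infty$. Then the following statements hold. (i) The composition operator $C_\varphi : A^p\to\mathcal{B}_0$ is bounded if and only if $C_\varphi : A^p\to\mathcal{B}$ is bounded and $\varphi\in\mathcal{B}_0$. (ii) $C_\varphi : A^p\to\mathcal{B}_0$ is compact if and only if $$\lim_{|z|\to1}\frac{(1-|z|^2)}{(1-|\varphi(z)|^2)^{1+2/p}}|\varphi'(z)|=0.$$
   Context: $D$ is the open unit disk in $\mathbb{C}$ and $H(D)$ is the class of all analytic functions on $D$. An analytic self-map of $D$ is an analytic function $\varphi:D\to D$; it induces the composition operator $C_\varphi f=f\circ\varphi$, $f\in H(D)$. For $0<p<\infty$, the Bergman space $A^p$ is the space of $f\in H(D)$ with $\int_D|f(z)|^p\,dA(z)<\infty$, where $dA$ is the normalized Lebesgue area measure on $D$ ($A(D)=1$), with the usual norm (quasinorm if $p<1$) $\left(\int_D|f|^p\,dA\right)^{1/p}$. The Bloch space $\mathcal{B}$ is the space of $f\in H(D)$ with $B(f)=\sup_{z\in D}(1-|z|^2)|f'(z)|<\infty$, normed by $\|f\|_{\mathcal{B}}=|f(0)|+B(f)$. The little Bloch space $\mathcal{B}_0$ is the subspace of those $f\in\mathcal{B}$ with $(1-|z|^2)|f'(z)|\to0$ as $|z|\to1$, with the norm of $\mathcal{B}$. A linear operator is bounded if it maps the first space into the second and the image of every bounded set is bounded; it is compact if it maps the first space into the second and takes bounded sets to sets with compact closure. *)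

theory Defs
  imports "HOL-Complex_Analysis.Complex_Analysis"
begin

abbreviation unit_disk :: "complex set"
  where "unit_disk \<equiv> ball 0 1"

text \<open>
  A function on the disk is represented by its extension by zero to the whole complex plane, so
  that equality of functions on the disk is equality in HOL and the spaces below are closed under
  the pointwise operations.
\<close>
definition H_disk :: "(complex \<Rightarrow> complex) set"
  where "H_disk = {f. f holomorphic_on unit_disk \<and> (\<forall>z. z \<notin> unit_disk \<longrightarrow> f z = 0)}"

definition analytic_self_map :: "(complex \<Rightarrow> complex) \<Rightarrow> bool"
  where "analytic_self_map \<phi> \<longleftrightarrow> \<phi> \<in> H_disk \<and> \<phi> ` unit_disk \<subseteq> unit_disk"

definition composition_op :: "(complex \<Rightarrow> complex) \<Rightarrow> (complex \<Rightarrow> complex) \<Rightarrow> (complex \<Rightarrow> complex)"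
  where "composition_op \<phi> f = (\<lambda>z. if z \<in> unit_disk then f (\<phi> z) else 0)"

definition disk_area :: "complex measure"
  where "disk_area = uniform_measure lborel unit_disk"

definition bergman :: "real \<Rightarrow> (complex \<Rightarrow> complex) set"
  where "bergman p = {f \<in> H_disk. integrable disk_area (\<lambda>z. norm (f z) powr p)}"

definition bergman_norm :: "real \<Rightarrow> (complex \<Rightarrow> complex) \<Rightarrow> real"
  where "bergman_norm p f = (\<integral>z. norm (f z) powr p \<partial>disk_area) powr (1 / p)"

definition bloch_weight :: "(complex \<Rightarrow> complex) \<Rightarrow> complex \<Rightarrow> real"
  where "bloch_weight f z = (1 - (norm z)\<^sup>2) * norm (deriv f z)"

definition bloch :: "(complex \<Rightarrow> complex) set"
  where "bloch = {f \<in> H_disk. bdd_above (bloch_weight f ` unit_disk)}"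

definition bloch_norm :: "(complex \<Rightarrow> complex) \<Rightarrow> real"
  where "bloch_norm f = norm (f 0) + (SUP z\<in>unit_disk. bloch_weight f z)"

text \<open>The filter for the limit as \<open>|z|\<close> tends to 1 with \<open>z\<close> inside the disk.\<close>
definition to_unit_circle :: "complex filter"
  where "to_unit_circle = filtercomap norm (at_left (1::real))"

definition little_bloch :: "(complex \<Rightarrow> complex) set"
  where "little_bloch = {f \<in> bloch. (bloch_weight f \<longlongrightarrow> 0) to_unit_circle}"

definition norm_bounded :: "((complex \<Rightarrow> complex) \<Rightarrow> real) \<Rightarrow> (complex \<Rightarrow> complex) set \<Rightarrow> bool"
  where "norm_bounded N S \<longleftrightarrow> (\<exists>C. \<forall>f\<in>S. N f \<le> C)"

text \<open>
  The locale \<^locale>\<open>Metric_space\<close> asks for a nonnegative distance on the whole type, while the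
  supremum in \<^const>\<open>bloch_norm\<close> has no meaning outside \<^const>\<open>bloch\<close>; hence the case distinction,
  which does not affect distances between points of \<open>Y\<close>.
\<close>
definition norm_dist :: "((complex \<Rightarrow> complex) \<Rightarrow> real) \<Rightarrow> (complex \<Rightarrow> complex) set
    \<Rightarrow> (complex \<Rightarrow> complex) \<Rightarrow> (complex \<Rightarrow> complex) \<Rightarrow> real"
  where "norm_dist N Y f g = (if f \<in> Y \<and> g \<in> Y then N (\<lambda>z. f z - g z) else 0)"

definition norm_topology :: "((complex \<Rightarrow> complex) \<Rightarrow> real) \<Rightarrow> (complex \<Rightarrow> complex) set
    \<Rightarrow> (complex \<Rightarrow> complex) topology"
  where "norm_topology N Y = Metric_space.mtopology Y (norm_dist N Y)"

definition bounded_op ::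
  "((complex \<Rightarrow> complex) \<Rightarrow> real) \<Rightarrow> (complex \<Rightarrow> complex) set
   \<Rightarrow> ((complex \<Rightarrow> complex) \<Rightarrow> real) \<Rightarrow> (complex \<Rightarrow> complex) set
   \<Rightarrow> ((complex \<Rightarrow> complex) \<Rightarrow> (complex \<Rightarrow> complex)) \<Rightarrow> bool"
  where "bounded_op N X N' Y T \<longleftrightarrow>
    T ` X \<subseteq> Y \<and> (\<forall>S\<subseteq>X. norm_bounded N S \<longrightarrow> norm_bounded N' (T ` S))"

definition compact_op ::
  "((complex \<Rightarrow> complex) \<Rightarrow> real) \<Rightarrow> (complex \<Rightarrow> complex) set
   \<Rightarrow> ((complex \<Rightarrow> complex) \<Rightarrow> real) \<Rightarrow> (complex \<Rightarrow> complex) set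
   \<Rightarrow> ((complex \<Rightarrow> complex) \<Rightarrow> (complex \<Rightarrow> complex)) \<Rightarrow> bool"
  where "compact_op N X N' Y T \<longleftrightarrow>
    T ` X \<subseteq> Y \<and>
    (\<forall>S\<subseteq>X. norm_bounded N S \<longrightarrow>
       compactin (norm_topology N' Y) (norm_topology N' Y closure_of (T ` S)))"

text \<open>The distance on the two Bloch spaces is a metric, so \<^const>\<open>norm_topology\<close> is the topology of
  the norm there.\<close>

lemma bloch_weight_nonneg: "z \<in> unit_disk \<Longrightarrow> 0 \<le> bloch_weight f z"
  by (auto simp: bloch_weight_def intro!: mult_nonneg_nonneg simp: abs_square_le_1)

lemma H_disk_deriv:
  "f \<in> H_disk \<Longrightarrow> z \<in> unit_disk \<Longrightarrow> (f has_field_derivative deriv f z) (at z)"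
  by (auto simp: H_disk_def intro: holomorphic_derivI[OF _ open_ball])

lemma H_disk_diff: "f \<in> H_disk \<Longrightarrow> g \<in> H_disk \<Longrightarrow> (\<lambda>z. f z - g z) \<in> H_disk"
  by (auto simp: H_disk_def intro!: holomorphic_intros)

lemma deriv_diff_H_disk:
  assumes "f \<in> H_disk" "g \<in> H_disk" "z \<in> unit_disk"
  shows "deriv (\<lambda>w. f w - g w) z = deriv f z - deriv g z"
  using assms by (intro DERIV_imp_deriv derivative_intros H_disk_deriv)

lemma bloch_weight_diff_le:
  assumes "f \<in> H_disk" "g \<in> H_disk" "z \<in> unit_disk"
  shows "bloch_weight (\<lambda>w. f w - g w) z \<le> bloch_weight f z + bloch_weight g z"
proof -
  have "0 \<le> 1 - (norm z)\<^sup>2"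
    using assms by (simp add: abs_square_le_1)
  then show ?thesis
    using mult_left_mono[OF norm_triangle_ineq4[of "deriv f z" "deriv g z"]]
    by (auto simp: bloch_weight_def deriv_diff_H_disk[OF assms] distrib_left[symmetric])
qed

lemma bloch_diff:
  assumes "f \<in> bloch" "g \<in> bloch"
  shows "(\<lambda>z. f z - g z) \<in> bloch"
proof -
  obtain a b where ab: "\<And>z. z \<in> unit_disk \<Longrightarrow> bloch_weight f z \<le> a"
      "\<And>z. z \<in> unit_disk \<Longrightarrow> bloch_weight g z \<le> b"
    using assms unfolding bloch_def bdd_above_def by blast
  have *: "f \<in> H_disk" "g \<in> H_disk"
    using assms by (auto simp: bloch_def)
  have "bloch_weight (\<lambda>z. f z - g z) z \<le> a + b" if "z \<in> unit_disk" for z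
    using bloch_weight_diff_le[OF * that] ab[OF that] by linarith
  then show ?thesis
    using H_disk_diff[OF *] unfolding bloch_def bdd_above_def by blast
qed

lemma bloch_weight_le_SUP:
  assumes "f \<in> bloch" "z \<in> unit_disk"
  shows "bloch_weight f z \<le> (SUP z\<in>unit_disk. bloch_weight f z)"
  using assms by (intro cSUP_upper) (auto simp: bloch_def)

lemma bloch_SUP_nonneg: "f \<in> bloch \<Longrightarrow> 0 \<le> (SUP z\<in>unit_disk. bloch_weight f z)"
  using bloch_weight_le_SUP[of f 0] bloch_weight_nonneg[of 0 f] by force

lemma bloch_norm_eq_0:
  assumes "f \<in> bloch" "bloch_norm f = 0"
  shows "f z = 0"
proof (cases "z \<in> unit_disk")
  case True
  have 0: "f 0 = 0" "(SUP z\<in>unit_disk. bloch_weight f z) = 0"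
    using assms bloch_SUP_nonneg[OF assms(1)] norm_ge_zero[of "f 0"]
    unfolding bloch_norm_def by (simp_all add: add_nonneg_eq_0_iff)
  have H: "f \<in> H_disk" using assms by (simp add: bloch_def)
  have "(f has_field_derivative 0) (at w within unit_disk)" if w: "w \<in> unit_disk" for w
  proof -
    have "bloch_weight f w = 0"
      using bloch_weight_le_SUP[OF assms(1) w] bloch_weight_nonneg[OF w, of f] 0 by simp
    moreover have "(norm w)\<^sup>2 \<noteq> 1"
      using w norm_ge_zero[of w] by (auto simp: power2_eq_1_iff simp del: norm_ge_zero)
    ultimately have "deriv f w = 0"
      by (auto simp: bloch_weight_def)
    then show ?thesis
      using H_disk_deriv[OF H w] by (simp add: has_field_derivative_at_within)
  qed
  then obtain c where "\<And>w. w \<in> unit_disk \<Longrightarrow> f w = c"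
    using has_field_derivative_zero_constant[of unit_disk f] by auto
  then show ?thesis
    using True 0(1) by (metis centre_in_ball zero_less_one)
next
  case False
  then show ?thesis
    using assms by (auto simp: bloch_def H_disk_def)
qed

lemma Metric_space_bloch_subset:
  assumes Y: "Y \<subseteq> bloch"
  shows "Metric_space Y (norm_dist bloch_norm Y)"
proof
  fix f g :: "complex \<Rightarrow> complex"
  show "0 \<le> norm_dist bloch_norm Y f g"
    using Y bloch_SUP_nonneg[OF bloch_diff[of f g]]
    by (auto simp: norm_dist_def bloch_norm_def subset_iff intro!: add_nonneg_nonneg)
  have "bloch_weight (\<lambda>z. f z - g z) w = bloch_weight (\<lambda>z. g z - f z) w"
    if "f \<in> Y" "g \<in> Y" "w \<in> unit_disk" for w
    using that Y
    by (auto simp: bloch_weight_def deriv_diff_H_disk bloch_def norm_minus_commute subset_iff)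
  then show "norm_dist bloch_norm Y f g = norm_dist bloch_norm Y g f"
    by (auto simp: norm_dist_def bloch_norm_def norm_minus_commute)
next
  fix f g assume fg: "f \<in> Y" "g \<in> Y"
  show "norm_dist bloch_norm Y f g = 0 \<longleftrightarrow> f = g"
  proof
    assume "norm_dist bloch_norm Y f g = 0"
    then have "bloch_norm (\<lambda>z. f z - g z) = 0"
      using fg by (simp add: norm_dist_def)
    then have "f z - g z = 0" for z
      using bloch_norm_eq_0[OF bloch_diff[of f g], of z] fg Y by auto
    then show "f = g"
      by (auto simp: fun_eq_iff)
  next
    assume "f = g"
    then show "norm_dist bloch_norm Y f g = 0"
      using fg by (simp add: norm_dist_def bloch_norm_def bloch_weight_def)
  qed
next
  fix f g h assume "f \<in> Y" "g \<in> Y" "h \<in> Y"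
  then have B: "f \<in> bloch" "g \<in> bloch" "h \<in> bloch" using Y by auto
  then have H: "f \<in> H_disk" "g \<in> H_disk" "h \<in> H_disk" by (auto simp: bloch_def)
  have "(SUP z\<in>unit_disk. bloch_weight (\<lambda>z. f z - h z) z)
      \<le> (SUP z\<in>unit_disk. bloch_weight (\<lambda>z. f z - g z) z)
        + (SUP z\<in>unit_disk. bloch_weight (\<lambda>z. g z - h z) z)"
  proof (rule cSUP_least)
    fix z assume z: "z \<in> unit_disk"
    have "0 \<le> 1 - (norm z)\<^sup>2"
      using z by (simp add: abs_square_le_1)
    then have "bloch_weight (\<lambda>z. f z - h z) z
        \<le> bloch_weight (\<lambda>z. f z - g z) z + bloch_weight (\<lambda>z. g z - h z) z"
      using mult_left_mono[OF norm_triangle_ineq[of "deriv f z - deriv g z" "deriv g z - deriv h z"]]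
      by (auto simp: bloch_weight_def deriv_diff_H_disk[OF _ _ z] H distrib_left[symmetric])
    then show "bloch_weight (\<lambda>z. f z - h z) z
        \<le> (SUP z\<in>unit_disk. bloch_weight (\<lambda>z. f z - g z) z)
          + (SUP z\<in>unit_disk. bloch_weight (\<lambda>z. g z - h z) z)"
      using bloch_weight_le_SUP[OF bloch_diff[OF B(1,2)] z]
        bloch_weight_le_SUP[OF bloch_diff[OF B(2,3)] z] by linarith
  qed simp
  moreover have "norm (f 0 - h 0) \<le> norm (f 0 - g 0) + norm (g 0 - h 0)"
    using norm_triangle_ineq[of "f 0 - g 0" "g 0 - h 0"] by simp
  ultimately show "norm_dist bloch_norm Y f h \<le> norm_dist bloch_norm Y f g + norm_dist bloch_norm Y g h"
    using \<open>f \<in> Y\<close> \<open>g \<in> Y\<close> \<open>h \<in> Y\<close> by (simp add: norm_dist_def bloch_norm_def)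
qed

interpretation bloch: Metric_space bloch "norm_dist bloch_norm bloch"
  by (rule Metric_space_bloch_subset) simp

interpretation little_bloch: Metric_space little_bloch "norm_dist bloch_norm little_bloch"
  by (rule Metric_space_bloch_subset) (auto simp: little_bloch_def)

end

theory Submission
  imports Defs
begin

text \<open>
  Write \<open>\<alpha> = 1 + 2/p\<close>. By the chain rule, the Bloch weight of \<open>f \<circ> \<phi>\<close> at \<open>z\<close> is a product of
  two factors:
  \<open>(1 - |z|\<^sup>2) |(f \<circ> \<phi>)'(z)| = q(z) \<cdot> (1 - |\<phi>(z)|\<^sup>2)\<^sup>\<alpha> |f'(\<phi>(z))|\<close>, where
  \<open>q(z) = (1 - |z|\<^sup>2) |\<phi>'(z)| / (1 - |\<phi>(z)|\<^sup>2)\<^sup>\<alpha>\<close> depends on \<open>\<phi>\<close> alone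
  (\<open>bergman_bloch_distortion\<close>) and the other factor depends on \<open>f\<close> alone
  (\<open>bergman_deriv_weight\<close>). Everything follows from knowing how large the second factor can be.

  Upper bounds. For \<open>f\<close> in the Bergman space the factor \<open>(1 - |w|\<^sup>2)\<^sup>\<alpha> |f'(w)|\<close> is at most a
  constant times the norm of \<open>f\<close>, and for a single \<open>f\<close> it tends to 0 at the circle
  (\<open>bergman_deriv_bound\<close>, \<open>bergman_deriv_tendsto_0\<close>). Both come from one local estimate: it is
  controlled by the integral of \<open>|f|\<^sup>p\<close> over the ball with centre \<open>w\<close> and radius \<open>(1 - |w|)/2\<close>, which
  is at most the integral over the disk and is part of the tail of a convergent integral when \<open>w\<close> is
  near the circle. The local estimate rests on the sub-mean value inequality for \<open>|f|\<^sup>p\<close>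
  (\<open>sub_mean_value_powr\<close>), up to a constant and for every \<open>p > 0\<close>.

  Lower bounds. For each \<open>a\<close> away from 0 the function
  \<open>(1 - |a|\<^sup>2)\<^sup>N\<^sup>-\<^sup>2\<^sup>/\<^sup>p / (1 - cnj a \<cdot> z)\<^sup>N\<close> has Bergman norm bounded independently of \<open>a\<close>, while its
  weighted derivative at \<open>a\<close> is \<open>N |a|\<close>. So a bound on the Bloch weights of the images of
  these functions at \<open>z\<close> is a bound on \<open>q(z)\<close> (\<open>distortion_le_peak_family\<close>); where \<open>|\<phi>(z)| \<le> 1/2\<close> one
  uses instead that \<open>q\<close> is comparable to the Bloch weight of \<open>\<phi>\<close>, and \<open>\<phi>\<close> is the image of the
  identity.

  For the first equivalence, boundedness into the Bloch space makes \<open>q\<close> bounded. Then the Bloch weight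
  of \<open>f \<circ> \<phi>\<close> at \<open>z\<close> is small if \<open>|\<phi>(z)|\<close> is near 1, because the weighted derivative of \<open>f\<close> is small
  there; elsewhere \<open>f'(\<phi>(z))\<close> is bounded and \<open>\<phi>\<close> being in the little Bloch space does the rest.

  For the second, a totally bounded subset of the little Bloch space decays uniformly at the circle,
  so that compactness, applied to the test functions, forces \<open>q \<rightarrow> 0\<close>. Conversely, if \<open>q \<rightarrow> 0\<close>, Montel's
  theorem extracts from a bounded sequence a subsequence converging locally uniformly with its
  derivatives to some \<open>g\<close>. Near the circle the smallness of \<open>q\<close> and the uniform
  bound on the weighted derivatives control the Bloch weights of the differences, and on the rest of
  the disk \<open>\<phi>\<close> takes values in a compact set. The limit \<open>g\<close> inherits the weighted derivative bound,
  and this together with \<open>q \<rightarrow> 0\<close> puts \<open>g \<circ> \<phi>\<close> into the little Bloch space.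
\<close>

section \<open>Mean values over disks\<close>

text \<open>
  This isometry carries the invariance of Lebesgue measure under orthogonal maps of \<open>real^2\<close>
  over to rotations of the complex plane.
\<close>
definition vec2_to_complex :: "real^2 \<Rightarrow> complex"
  where "vec2_to_complex v = Complex (v $ 1) (v $ 2)"

definition complex_to_vec2 :: "complex \<Rightarrow> real^2"
  where "complex_to_vec2 z = vector [Re z, Im z]"

lemma complex_vec2_inverse [simp]:
  "vec2_to_complex (complex_to_vec2 z) = z" "complex_to_vec2 (vec2_to_complex v) = v"
  by (simp_all add: vec2_to_complex_def complex_to_vec2_def complex_eq_iff vec_eq_iff forall_2)

lemma measurable_vec2_to_complex [measurable]: "vec2_to_complex \<in> borel_measurable borel"
  unfolding vec2_to_complex_def[abs_def] complex_eq
  by (intro borel_measurable_continuous_onI continuous_intros)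

lemma vec2_to_complex_vimage_box:
  "vec2_to_complex -` box l u = box (complex_to_vec2 l) (complex_to_vec2 u)"
  by (auto simp: mem_box Basis_complex_def Basis_vec_def inner_axis exhaust_2 forall_2
      vec2_to_complex_def complex_to_vec2_def inner_complex_def UNIV_2)

lemma distr_vec2_to_complex: "distr lborel borel vec2_to_complex = lborel"
proof (rule lborel_eqI[symmetric])
  fix l u :: complex
  assume le: "\<And>b. b \<in> Basis \<Longrightarrow> l \<bullet> b \<le> u \<bullet> b"
  have "Re l \<le> Re u" "Im l \<le> Im u"
    using le[of 1] le[of \<i>] by (auto simp: Basis_complex_def inner_complex_def)
  then show "emeasure (distr lborel borel vec2_to_complex) (box l u)
      = (\<Prod>b\<in>Basis. (u - l) \<bullet> b)"
    by (simp add: emeasure_distr vec2_to_complex_vimage_box emeasure_lborel_box_eq Basis_complex_def Basis_vec_def UNIV_2 inner_axis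
       complex_to_vec2_def inner_complex_def axis_eq_axis)
qed simp

text \<open>
  A rotation is conjugate, through \<open>vec2_to_complex\<close>, to an orthogonal map of \<open>real^2\<close>. Hence the
  image measure agrees with Lebesgue measure on boxes, which determines it.
\<close>
lemma lborel_complex_rotate:
  assumes "norm \<omega> = 1"
  shows "distr lborel borel (\<lambda>z::complex. \<omega> * z) = lborel"
proof (rule lborel_eqI[symmetric])
  fix l u :: complex
  assume le: "\<And>b. b \<in> Basis \<Longrightarrow> l \<bullet> b \<le> u \<bullet> b"
  \<comment> \<open>the inverse rotation, which turns the preimage of a box into an image\<close>
  define T where "T = (\<lambda>v. complex_to_vec2 (cnj \<omega> * vec2_to_complex v))"
  have "linear T"
    by (intro linearI) (auto simp: T_def vec_eq_iff forall_2 complex_to_vec2_def vec2_to_complex_def algebra_simps)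
  moreover have nrm: "norm (vec2_to_complex v) = norm v" for v
    by (simp add: vec2_to_complex_def norm_vec_def L2_set_def sum_2 cmod_def)
  have "norm (T v) = norm v" for v
  proof -
    have "norm (T v) = norm (vec2_to_complex (T v))" by (simp only: nrm)
    also have "\<dots> = norm v" by (simp add: T_def norm_mult assms nrm)
    finally show ?thesis .
  qed
  ultimately have orth: "orthogonal_transformation T"
    by (simp add: orthogonal_transformation)
  let ?B = "vec2_to_complex -` box l u"
  have cancel: "\<omega> * (cnj \<omega> * z) = z" "cnj \<omega> * (\<omega> * z) = z" for z
    using assms by (simp_all add: mult.assoc[symmetric] complex_norm_square[symmetric] mult.commute[of "cnj \<omega>"])
  have eq: "vec2_to_complex -` ((\<lambda>z. \<omega> * z) -` box l u) = T ` ?B"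
  proof (intro set_eqI iffI)
    fix v assume "v \<in> vec2_to_complex -` ((\<lambda>z. \<omega> * z) -` box l u)"
    then have "complex_to_vec2 (\<omega> * vec2_to_complex v) \<in> ?B" by simp
    moreover have "v = T (complex_to_vec2 (\<omega> * vec2_to_complex v))" by (simp add: T_def cancel)
    ultimately show "v \<in> T ` ?B" by blast
  qed (auto simp: T_def cancel)
  have [measurable]: "(\<lambda>z. \<omega> * z) \<in> borel_measurable borel"
    by measurable
  have ms: "((\<lambda>z. \<omega> * z) -` box l u) \<in> sets borel"
    using measurable_sets_borel[of "\<lambda>z. \<omega> * z" borel "box l u"] by simp
  have ms2: "vec2_to_complex -` ((\<lambda>z. \<omega> * z) -` box l u) \<in> sets borel"
    using measurable_sets_borel[OF measurable_vec2_to_complex ms] by simp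
  have ms3: "?B \<in> sets borel"
    using measurable_sets_borel[OF measurable_vec2_to_complex, of "box l u"] by simp
  have fm: "?B \<in> lmeasurable" by (simp add: vec2_to_complex_vimage_box)
  have "emeasure (distr lborel borel (\<lambda>z. \<omega> * z)) (box l u)
     = emeasure (distr lborel borel vec2_to_complex) ((\<lambda>z. \<omega> * z) -` box l u)"
    by (simp add: emeasure_distr distr_vec2_to_complex)
  also have "\<dots> = emeasure lborel (vec2_to_complex -` ((\<lambda>z. \<omega> * z) -` box l u))"
    using ms by (simp add: emeasure_distr)
  also have "\<dots> = emeasure lebesgue (T ` ?B)"
    using ms2 by (simp add: eq[symmetric] )
  also have "\<dots> = emeasure lebesgue ?B"
    using measure_orthogonal_image[OF orth fm] measurable_orthogonal_image[OF orth fm] fm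
    by (simp add: emeasure_eq_measure2)
  also have "\<dots> = emeasure (distr lborel borel vec2_to_complex) (box l u)"
    using ms3 by (simp add: emeasure_distr)
  also have "\<dots> = (\<Prod>b\<in>Basis. (u - l) \<bullet> b)"
    using le by (simp add: distr_vec2_to_complex)
  finally show "emeasure (distr lborel borel (\<lambda>z. \<omega> * z)) (box l u) = (\<Prod>b\<in>Basis. (u - l) \<bullet> b)" .
qed simp

lemma measure_ball_complex:
  "0 \<le> r \<Longrightarrow> measure lborel (ball (z::complex) r) = pi * r\<^sup>2"
  using content_ball[of r z] by (simp add: unit_ball_vol_2)

lemma emeasure_ball_complex:
  "0 \<le> r \<Longrightarrow> emeasure lborel (ball (z::complex) r) = ennreal (pi * r\<^sup>2)"
  using emeasure_ball[of r z] by (simp add: unit_ball_vol_2)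

lemma set_integrable_ball_continuous:
  fixes f :: "complex \<Rightarrow> 'b::{banach, second_countable_topology}"
  assumes "continuous_on (cball z r) f"
  shows "set_integrable lborel (ball z r) f"
proof -
  have "set_integrable lborel (cball z r) f"
    unfolding set_integrable_def by (intro borel_integrable_compact assms) simp
  then show ?thesis
    by (rule set_integrable_subset) auto
qed

text \<open>
  Rotating the ball about \<open>z\<close> by the angle \<open>\<pi>/n\<close> preserves the integral and changes the sign
  of the integrand.
\<close>
lemma integral_power_ball:
  assumes "0 < n"
  shows "(LINT w:ball z r|lborel. (w - z) ^ n) = (0::complex)"
proof -
  define g :: "complex \<Rightarrow> complex" where "g = (\<lambda>w. indicator (ball 0 r) w *\<^sub>R w ^ n)"
  have [measurable]: "g \<in> borel_measurable borel"
    unfolding g_def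
    by (intro borel_measurable_scaleR borel_measurable_indicator borel_measurable_continuous_onI
        continuous_intros) auto
  define \<omega> where "\<omega> = cis (pi / n)"
  have \<omega>: "norm \<omega> = 1" "\<omega> ^ n = -1"
    using assms by (auto simp: \<omega>_def Complex.DeMoivre)
  have "(\<integral>w. g w \<partial>lborel) = (\<integral>w. g w \<partial>distr lborel borel (\<lambda>w. \<omega> * w))"
    by (simp add: lborel_complex_rotate \<omega>)
  also have "\<dots> = (\<integral>w. g (\<omega> * w) \<partial>lborel)"
    by (subst integral_distr) auto
  also have "\<dots> = (\<integral>w. - g w \<partial>lborel)"
    by (intro Bochner_Integration.integral_cong)
       (auto simp: g_def norm_mult \<omega> power_mult_distrib indicator_def)
  finally have *: "(\<integral>w. g w \<partial>lborel) = 0" by simp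
  have "(LINT w:ball z r|lborel. (w - z) ^ n) = (\<integral>w. g (w - z) \<partial>lborel)"
    unfolding set_lebesgue_integral_def g_def
    by (intro Bochner_Integration.integral_cong) (auto simp: indicator_def dist_norm norm_minus_commute)
  also have "\<dots> = (\<integral>w. g (w - z) \<partial>distr lborel borel ((+) z))"
    by (simp add: lborel_distr_plus)
  also have "\<dots> = (\<integral>w. g w \<partial>lborel)"
    by (subst integral_distr) auto
  finally show ?thesis using * by simp
qed

text \<open>
  The Taylor series converges absolutely and uniformly on the smaller ball, so it may be integrated
  termwise, and \<open>integral_power_ball\<close> leaves the constant term only.
\<close>
lemma mean_value_ball:
  fixes f :: "complex \<Rightarrow> complex"
  assumes f: "f holomorphic_on ball z R" and r: "0 < r" "r < R"
  shows "(LINT w:ball z r|lborel. f w) = pi * r\<^sup>2 * f z"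
proof -
  define a where "a n = (deriv ^^ n) f z / fact n" for n
  have sums: "(\<lambda>n. a n * (w - z) ^ n) sums f w" if "w \<in> ball z R" for w
    using holomorphic_power_series[OF f that] by (simp add: a_def)
  obtain s where s: "r < s" "s < R" using r dense by blast
  have abs: "summable (\<lambda>n. norm (a n * (of_real r) ^ n))"
  proof (rule powser_insidea)
    show "summable (\<lambda>n. a n * (complex_of_real s) ^ n)"
      using sums[of "z + of_real s"] s r by (auto simp: dist_norm sums_iff)
  qed (use r s in auto)
  have abs_w: "summable (\<lambda>n. norm (a n * (w - z) ^ n))" if "w \<in> ball z r" for w
  proof (rule powser_insidea)
    show "summable (\<lambda>n. a n * (complex_of_real r) ^ n)"
      using summable_norm_cancel[OF abs] .
  qed (use r that in \<open>auto simp: dist_norm norm_minus_commute\<close>)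
  let ?h = "\<lambda>n w. indicator (ball z r) w *\<^sub>R (a n * (w - z) ^ n)"
  have int: "integrable lborel (?h n)" for n
    using set_integrable_ball_continuous[of z r "\<lambda>w. a n * (w - z) ^ n"]
    by (simp add: set_integrable_def continuous_intros)
  have "(\<lambda>n. integral\<^sup>L lborel (?h n)) sums (\<integral>w. (\<Sum>n. ?h n w) \<partial>lborel)"
  proof (rule sums_integral[OF int])
    show "AE w in lborel. summable (\<lambda>n. norm (?h n w))"
    proof (intro always_eventually allI)
      fix w show "summable (\<lambda>n. norm (?h n w))"
        using abs_w[of w] by (cases "w \<in> ball z r") (auto simp: indicator_def)
    qed
    have "(\<integral>w. norm (?h n w) \<partial>lborel) \<le> norm (a n * of_real r ^ n) * (pi * r\<^sup>2)" for n
    proof -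
      have "(\<integral>w. norm (?h n w) \<partial>lborel)
          \<le> (\<integral>w. norm (a n * of_real r ^ n) * indicator (ball z r) w \<partial>lborel)"
      proof (intro integral_mono integrable_norm int)
        show "integrable lborel (\<lambda>w. norm (a n * complex_of_real r ^ n) * indicator (ball z r) w :: real)"
          by (intro integrable_mult_right integrable_real_indicator)
             (auto simp: emeasure_lborel_ball_finite[unfolded infinity_ennreal_def])
        fix w
        show "norm (?h n w) \<le> norm (a n * of_real r ^ n) * indicator (ball z r) w"
          using r by (auto simp: indicator_def norm_mult norm_power dist_norm norm_minus_commute
              intro!: mult_left_mono power_mono)
      qed
      also have "\<dots> = norm (a n * of_real r ^ n) * (pi * r\<^sup>2)"
        using r by (simp add: measure_ball_complex)
      finally show ?thesis .
    qed
    then show "summable (\<lambda>n. \<integral>w. norm (?h n w) \<partial>lborel)"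
      using abs
      by (intro summable_comparison_test'[OF summable_mult2[OF abs, of "pi * r\<^sup>2"]]) auto
  qed
  moreover have "(\<integral>w. (\<Sum>n. ?h n w) \<partial>lborel) = (LINT w:ball z r|lborel. f w)"
    unfolding set_lebesgue_integral_def
  proof (intro Bochner_Integration.integral_cong refl)
    fix w show "(\<Sum>n. ?h n w) = indicator (ball z r) w *\<^sub>R f w"
      using sums[of w] r by (auto simp: indicator_def sums_iff)
  qed
  moreover have "integral\<^sup>L lborel (?h n) = (if n = 0 then pi * r\<^sup>2 * f z else 0)" for n
  proof (cases "n = 0")
    case True
    have "integral\<^sup>L lborel (?h n) = measure lborel (ball z r) *\<^sub>R a 0"
      using True has_bochner_integral_indicator[of "ball z r" lborel "a 0"]
      by (simp add: has_bochner_integral_iff emeasure_lborel_ball_finite[unfolded infinity_ennreal_def])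
    then show ?thesis
      using True r by (simp add: a_def measure_ball_complex scaleR_conv_of_real)
  next
    case False
    have "integral\<^sup>L lborel (?h n) = a n * (LINT w:ball z r|lborel. (w - z) ^ n)"
      using set_integral_mult_right[where a = "a n" and f = "\<lambda>w. (w - z) ^ n"
          and A = "ball z r" and M = lborel]
      by (simp only: set_lebesgue_integral_def)
    with False show ?thesis by (simp add: integral_power_ball)
  qed
  ultimately have "(\<lambda>n. if n = 0 then pi * r\<^sup>2 * f z else 0) sums (LINT w:ball z r|lborel. f w)"
    by simp
  moreover have "(\<lambda>n. if n = 0 then pi * r\<^sup>2 * f z else 0) sums (pi * r\<^sup>2 * f z)"
    using sums_If_finite[of "\<lambda>n. n = 0" "\<lambda>n. pi * r\<^sup>2 * f z"] by simp
  ultimately show ?thesis using sums_unique2 by blast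
qed

lemma sub_mean_value_ball:
  assumes "f holomorphic_on ball z R" "0 < r" "r < R"
  shows "pi * r\<^sup>2 * norm (f z) \<le> (LINT w:ball z r|lborel. norm (f w))"
proof -
  have "pi * r\<^sup>2 * norm (f z) = norm (LINT w:ball z r|lborel. f w)"
    by (simp add: mean_value_ball[OF assms] norm_mult norm_power)
  also have "\<dots> \<le> (LINT w:ball z r|lborel. norm (f w))"
  proof (rule set_integral_norm_bound, rule set_integrable_ball_continuous)
    show "continuous_on (cball z r) f"
      using assms by (intro holomorphic_on_imp_continuous_on holomorphic_on_subset[OF assms(1)]) auto
  qed
  finally show ?thesis .
qed

section \<open>The sub-mean value inequality for powers\<close>

lemma set_integrable_powr_ball:
  fixes f :: "complex \<Rightarrow> complex"
  assumes "f holomorphic_on ball z R" "r < R" "0 < p"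
  shows "set_integrable lborel (ball z r) (\<lambda>w. norm (f w) powr p)"
proof (rule set_integrable_ball_continuous)
  have "continuous_on (cball z r) f"
    using assms by (intro holomorphic_on_imp_continuous_on holomorphic_on_subset[OF assms(1)]) auto
  then show "continuous_on (cball z r) (\<lambda>w. norm (f w) powr p)"
    using assms(3) by (intro continuous_on_powr' continuous_intros) auto
qed

lemma set_integral_mono_domain:
  fixes g :: "'a \<Rightarrow> real"
  assumes "set_integrable M B g" "A \<in> sets M" "A \<subseteq> B" "\<And>x. x \<in> B \<Longrightarrow> 0 \<le> g x"
  shows "(LINT x:A|M. g x) \<le> (LINT x:B|M. g x)"
  unfolding set_lebesgue_integral_def
proof (rule integral_mono)
  show "integrable M (\<lambda>x. indicator A x *\<^sub>R g x)"
    using set_integrable_subset[OF assms(1-3)] by (simp add: set_integrable_def)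
  show "integrable M (\<lambda>x. indicator B x *\<^sub>R g x)"
    using assms(1) by (simp add: set_integrable_def)
qed (use assms in \<open>auto simp: indicator_def\<close>)

text \<open>
  This replaces both Hoelder's inequality (for \<open>p \<ge> 1\<close>) and the bound
  \<open>t \<le> t\<^sup>p \<cdot> (sup)\<^sup>1\<^sup>-\<^sup>p\<close> (for \<open>p < 1\<close>): either \<open>t\<close> is at most \<open>m/2\<close>, or \<open>t/m\<close>
  lies between \<open>1/2\<close> and \<open>K\<close>, where \<open>s\<^sup>1\<^sup>-\<^sup>p\<close> is bounded.
\<close>
lemma le_half_plus_powr:
  fixes m t K p :: real
  assumes "0 < m" "0 \<le> t" "t \<le> K * m"
  shows "t \<le> m / 2 + ((1/2) powr (1 - p) + K powr (1 - p)) * m powr (1 - p) * t powr p"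
proof (cases "t \<le> m / 2")
  case True
  then show ?thesis by (simp add: add_increasing2)
next
  case False
  define s where "s = t / m"
  have s: "1 / 2 \<le> s" "s \<le> K" "t = s * m"
    using False assms by (auto simp: s_def field_simps)
  have "s powr (1 - p) \<le> (1/2) powr (1 - p) + K powr (1 - p)"
  proof (cases "p \<le> 1")
    case True
    then have "s powr (1 - p) \<le> K powr (1 - p)" using s by (intro powr_mono2) auto
    then show ?thesis by (simp add: add_increasing)
  next
    case False
    then have "s powr (1 - p) \<le> (1/2) powr (1 - p)" using s by (intro powr_mono2') auto
    then show ?thesis by (simp add: add_increasing2)
  qed
  then have *: "s powr (1 - p) * m powr (1 - p) * t powr p
      \<le> ((1/2) powr (1 - p) + K powr (1 - p)) * m powr (1 - p) * t powr p"
    by (intro mult_right_mono) auto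
  have "t = t powr (1 - p) * t powr p"
    using False assms by (simp add: powr_add[symmetric])
  also have "t powr (1 - p) = s powr (1 - p) * m powr (1 - p)"
    using s assms by (simp add: powr_mult)
  finally have "t \<le> ((1/2) powr (1 - p) + K powr (1 - p)) * m powr (1 - p) * t powr p"
    using * by simp
  then show ?thesis using assms by simp
qed

text \<open>
  Insert \<open>le_half_plus_powr\<close>, with \<open>t = |f(w)|\<close> and \<open>m = |f(u)|\<close>, into the sub-mean value
  inequality for \<open>|f|\<close>. The term \<open>m/2\<close> is absorbed on the left, and division by \<open>m\<^sup>1\<^sup>-\<^sup>p\<close> turns the
  remaining \<open>m\<close> into \<open>m\<^sup>p\<close>.
\<close>
lemma sub_mean_value_powr_at_max:
  fixes f :: "complex \<Rightarrow> complex"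
  assumes f: "f holomorphic_on ball u d" and d: "0 < d" and p: "0 < p"
    and m: "0 < norm (f u)"
    and bound: "\<And>w. w \<in> ball u (d / 2) \<Longrightarrow> norm (f w) \<le> K * norm (f u)"
  shows "pi * d\<^sup>2 * norm (f u) powr p
      \<le> 8 * ((1/2) powr (1 - p) + K powr (1 - p)) * (LINT w:ball u (d / 2)|lborel. norm (f w) powr p)"
proof -
  define m where "m = norm (f u)"
  define A where "A = (1/2) powr (1 - p) + K powr (1 - p)"
  define J where "J = (LINT w:ball u (d / 2)|lborel. norm (f w) powr p)"
  have m0: "0 < m" using m by (simp add: m_def)
  have int: "set_integrable lborel (ball u (d / 2)) (\<lambda>w. norm (f w) powr p)"
    using f d p by (intro set_integrable_powr_ball[of f u d]) auto
  have intc: "set_integrable lborel (ball u (d / 2)) (\<lambda>w. m / 2)"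
    by (rule set_integrable_ball_continuous) (rule continuous_on_const)
  have "continuous_on (cball u (d/2)) f"
    using d by (intro holomorphic_on_imp_continuous_on holomorphic_on_subset[OF f]) auto
  then have intf: "set_integrable lborel (ball u (d / 2)) (\<lambda>w. norm (f w))"
    by (intro set_integrable_ball_continuous continuous_intros)
  have "pi * (d / 2)\<^sup>2 * m \<le> (LINT w:ball u (d / 2)|lborel. norm (f w))"
    unfolding m_def using d by (intro sub_mean_value_ball[OF f]) auto
  also have "\<dots> \<le> (LINT w:ball u (d / 2)|lborel. m / 2 + A * m powr (1 - p) * norm (f w) powr p)"
  proof (rule set_integral_mono[OF intf])
    show "set_integrable lborel (ball u (d / 2)) (\<lambda>w. m / 2 + A * m powr (1 - p) * norm (f w) powr p)"
      by (intro set_integral_add intc set_integrable_mult_right int)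
    fix w assume "w \<in> ball u (d / 2)"
    then show "norm (f w) \<le> m / 2 + A * m powr (1 - p) * norm (f w) powr p"
      unfolding A_def using bound[of w] m0 by (intro le_half_plus_powr) (auto simp: m_def)
  qed
  also have "\<dots> = (LINT w:ball u (d / 2)|lborel. m / 2) + A * m powr (1 - p) * J"
    unfolding J_def
    by (subst set_integral_add(2)[OF intc set_integrable_mult_right])
       (simp_all only: int set_integral_mult_right simp_thms)
  also have "(LINT w:ball u (d / 2)|lborel. m / 2) = pi * (d / 2)\<^sup>2 * (m / 2)"
    using d by (simp add: set_lebesgue_integral_def measure_ball_complex)
  finally have "pi * d\<^sup>2 * m \<le> 8 * A * (m powr (1 - p)) * J"
    by (simp add: field_simps power2_eq_square)
  then have "(pi * d\<^sup>2 * m) * m powr (p - 1) \<le> (8 * A * (m powr (1 - p)) * J) * m powr (p - 1)"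
    by (intro mult_right_mono) auto
  then have "pi * d\<^sup>2 * (m * m powr (p - 1)) \<le> 8 * A * J * (m powr (1 - p) * m powr (p - 1))"
    by (simp only: mult_ac)
  moreover have "m * m powr (p - 1) = m powr p" "m powr (1 - p) * m powr (p - 1) = 1"
    using m0 by (simp_all add: powr_mult_base powr_add[symmetric])
  ultimately have "pi * d\<^sup>2 * m powr p \<le> 8 * A * J"
    by simp
  then show ?thesis by (simp add: m_def A_def J_def)
qed

text \<open>
  A maximum point \<open>u\<close> of \<open>G(v) = (r - |v - z|)\<^sup>2\<^sup>/\<^sup>p |f(v)|\<close> meets the hypothesis of
  \<open>sub_mean_value_powr_at_max\<close>, with \<open>K = 2\<^sup>2\<^sup>/\<^sup>p\<close>: on the ball about \<open>u\<close> of half the distance \<open>d\<close>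
  to the boundary, the weight has dropped at most by that factor. As \<open>G(z) \<le> G(u)\<close>,
  the bound for \<open>d\<^sup>2 |f(u)|\<^sup>p\<close> is a bound for \<open>r\<^sup>2 |f(z)|\<^sup>p\<close>. The exponent \<open>p\<close> is arbitrary, and
  subharmonicity of \<open>|f|\<^sup>p\<close> is avoided at the price of a constant.
\<close>
lemma sub_mean_value_powr:
  fixes p :: real
  assumes p: "0 < p"
  obtains C where "0 < C"
    and "\<And>(f::complex \<Rightarrow> complex) z r R. f holomorphic_on ball z R \<Longrightarrow> 0 < r \<Longrightarrow> r < R \<Longrightarrow>
           norm (f z) powr p * r\<^sup>2 \<le> C * (LINT w:ball z r|lborel. norm (f w) powr p)"
proof
  define K :: real where "K = 2 powr (2 / p)"
  define A where "A = (1/2) powr (1 - p) + K powr (1 - p)"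
  have A0: "0 < A"
    unfolding A_def K_def by (intro add_pos_nonneg) auto
  then show "0 < 8 * A / pi" by simp
  fix f :: "complex \<Rightarrow> complex" and z r R
  assume f: "f holomorphic_on ball z R" and r: "0 < r" "r < R"
  define I where "I = (LINT w:ball z r|lborel. norm (f w) powr p)"
  have I0: "0 \<le> I" unfolding I_def set_lebesgue_integral_def by (intro integral_nonneg_AE) auto
  show "norm (f z) powr p * r\<^sup>2 \<le> 8 * A / pi * I"
  proof (cases "f z = 0")
    case True
    then show ?thesis using p A0 I0 by simp
  next
    case False
    define G where "G u = (r - dist z u) powr (2 / p) * norm (f u)" for u
    have contf: "continuous_on (cball z r) f"
      using r by (intro holomorphic_on_imp_continuous_on holomorphic_on_subset[OF f]) auto
    have "continuous_on (cball z r) G"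
      unfolding G_def using p by (intro continuous_intros contf continuous_on_powr') auto
    moreover have "cball z r \<noteq> {}" using r by auto
    ultimately obtain u where u: "u \<in> cball z r" and max: "\<And>v. v \<in> cball z r \<Longrightarrow> G v \<le> G u"
      using continuous_attains_sup[OF compact_cball] by metis
    define d where "d = r - dist z u"
    have "0 < G z" using False r by (simp add: G_def)
    then have "0 < G u" using max[of z] r by simp
    then have d: "0 < d" and fu: "0 < norm (f u)"
      using u by (auto simp: G_def d_def zero_less_mult_iff order.order_iff_strict)
    have sub: "ball u d \<subseteq> ball z r"
    proof
      fix y assume "y \<in> ball u d"
      then show "y \<in> ball z r" using dist_triangle[of z y u] by (simp add: d_def)
    qed
    have bound: "norm (f w) \<le> K * norm (f u)" if w: "w \<in> ball u (d / 2)" for w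
    proof -
      have "dist z w \<le> dist z u + dist u w" by (rule dist_triangle)
      then have dw: "d / 2 \<le> r - dist z w" using w by (simp add: d_def)
      have "(d / 2) powr (2 / p) * norm (f w) \<le> G w"
        unfolding G_def using dw d p by (intro mult_right_mono powr_mono2) auto
      also have "\<dots> \<le> d powr (2 / p) * norm (f u)"
        using max[of w] dw d by (simp add: G_def d_def)
      also have "d powr (2 / p) = (d / 2) powr (2 / p) * K"
        using d by (simp add: K_def powr_mult[symmetric])
      finally show ?thesis using d by simp
    qed
    have "pi * d\<^sup>2 * norm (f u) powr p \<le> 8 * A * (LINT w:ball u (d / 2)|lborel. norm (f w) powr p)"
      unfolding A_def
    proof (rule sub_mean_value_powr_at_max)
      show "f holomorphic_on ball u d"
        using sub r by (intro holomorphic_on_subset[OF f]) auto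
    qed (use d p fu bound in auto)
    also have "\<dots> \<le> 8 * A * I"
    proof (intro mult_left_mono)
      show "(LINT w:ball u (d / 2)|lborel. norm (f w) powr p) \<le> I"
        unfolding I_def
      proof (rule set_integral_mono_domain[OF set_integrable_powr_ball[OF f r(2) p]])
        show "ball u (d / 2) \<subseteq> ball z r" using sub d by (auto simp: subset_iff)
      qed auto
    qed (use A0 in auto)
    finally have *: "d\<^sup>2 * norm (f u) powr p \<le> 8 * A / pi * I"
      by (simp add: field_simps)
    have Gp: "G v powr p = (r - dist z v)\<^sup>2 * norm (f v) powr p" if "v \<in> cball z r" for v
      using that p by (simp add: G_def powr_mult powr_powr)
    have "G z powr p \<le> G u powr p"
      using max[of z] r p by (intro powr_mono2) (auto simp: G_def)
    then have "r\<^sup>2 * norm (f z) powr p \<le> d\<^sup>2 * norm (f u) powr p"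
      using Gp[of z] Gp[of u] u r by (simp add: d_def)
    then show ?thesis using * by (simp add: mult.commute)
  qed
qed

text \<open>
  Cauchy's inequality on the circle of radius \<open>r\<close>; balls of radius \<open>r\<close> about its points stay in
  the ball of radius \<open>2r\<close>.
\<close>
lemma deriv_sub_mean_value_powr:
  fixes p :: real
  assumes p: "0 < p"
  obtains C where "0 < C"
    and "\<And>(f::complex \<Rightarrow> complex) z r R. f holomorphic_on ball z R \<Longrightarrow> 0 < r \<Longrightarrow> 2 * r < R \<Longrightarrow>
           r powr (1 + 2 / p) * norm (deriv f z)
             \<le> C * (LINT w:ball z (2 * r)|lborel. norm (f w) powr p) powr (1 / p)"
proof -
  obtain C where C: "0 < C" and sub: "\<And>(f::complex \<Rightarrow> complex) z r R. f holomorphic_on ball z R \<Longrightarrow> 0 < r \<Longrightarrow> r < R \<Longrightarrow>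
           norm (f z) powr p * r\<^sup>2 \<le> C * (LINT w:ball z r|lborel. norm (f w) powr p)"
    using sub_mean_value_powr[OF p] by blast
  show ?thesis
  proof
    show "0 < C powr (1 / p)" using C by simp
    fix f :: "complex \<Rightarrow> complex" and z r R
    assume f: "f holomorphic_on ball z R" and r: "0 < r" "2 * r < R"
    define I where "I = (LINT w:ball z (2 * r)|lborel. norm (f w) powr p)"
    have I0: "0 \<le> I" unfolding I_def set_lebesgue_integral_def by (intro integral_nonneg_AE) auto
    define B where "B = (C * I / r\<^sup>2) powr (1 / p)"
    have on_circle: "norm (f x) \<le> B" if x: "norm (z - x) = r" for x
    proof -
      have tri: "ball x s \<subseteq> ball z (r + s)" for s
      proof
        fix y assume "y \<in> ball x s"
        then show "y \<in> ball z (r + s)" using dist_triangle[of z y x] x by (simp add: dist_norm)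
      qed
      have "norm (f x) powr p * r\<^sup>2 \<le> C * (LINT w:ball x r|lborel. norm (f w) powr p)"
      proof (rule sub)
        show "f holomorphic_on ball x (R - r)"
          using tri[of "R - r"] by (intro holomorphic_on_subset[OF f]) auto
      qed (use r in auto)
      also have "\<dots> \<le> C * I"
      proof (intro mult_left_mono)
        show "(LINT w:ball x r|lborel. norm (f w) powr p) \<le> I"
          unfolding I_def
        proof (rule set_integral_mono_domain[OF set_integrable_powr_ball[OF f r(2) p]])
          show "ball x r \<subseteq> ball z (2 * r)"
            using tri[of r] by simp
        qed auto
      qed (use C in auto)
      finally have "norm (f x) powr p \<le> C * I / r\<^sup>2"
        using r by (simp add: field_simps)
      then have "(norm (f x) powr p) powr (1 / p) \<le> B"
        unfolding B_def using p by (intro powr_mono2) auto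
      then show ?thesis using p by (simp add: powr_powr)
    qed
    have "norm ((deriv ^^ 1) f z) \<le> fact 1 * B / r ^ 1"
    proof (rule Cauchy_inequality)
      show "f holomorphic_on ball z r"
        using r by (intro holomorphic_on_subset[OF f]) auto
      show "continuous_on (cball z r) f"
        using r by (intro holomorphic_on_imp_continuous_on holomorphic_on_subset[OF f]) auto
    qed (use r on_circle in auto)
    then have "norm (deriv f z) * r \<le> B" using r by (simp add: field_simps)
    then have "r powr (2 / p) * (norm (deriv f z) * r) \<le> r powr (2 / p) * B"
      by (intro mult_left_mono) auto
    also have "r powr (2 / p) = (r\<^sup>2) powr (1 / p)"
    proof -
      have "r\<^sup>2 = r powr 2" using r by simp
      then show ?thesis by (simp only: powr_powr) simp
    qed
    also have "(r\<^sup>2) powr (1 / p) * B = C powr (1 / p) * I powr (1 / p)"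
      unfolding B_def using C I0 r by (simp add: powr_mult[symmetric])
    finally have "(r\<^sup>2) powr (1 / p) * (norm (deriv f z) * r) \<le> C powr (1 / p) * I powr (1 / p)" .
    moreover have "r powr (1 + 2 / p) = (r\<^sup>2) powr (1 / p) * r"
    proof -
      have "r\<^sup>2 = r powr 2" using r by simp
      then show ?thesis using r by (simp only: powr_powr powr_add) simp
    qed
    ultimately show "r powr (1 + 2 / p) * norm (deriv f z) \<le> C powr (1 / p) * I powr (1 / p)"
      by (simp only: mult_ac)
  qed
qed

section \<open>Approach to the unit circle\<close>

lemma eventually_to_unit_circle:
  "eventually P to_unit_circle \<longleftrightarrow> (\<exists>b<1. \<forall>z. b < norm z \<and> norm z < 1 \<longrightarrow> P z)"
proof
  assume "eventually P to_unit_circle"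
  then obtain Q where Q: "eventually Q (at_left (1::real))" "\<And>z. Q (norm z) \<Longrightarrow> P z"
    by (auto simp: to_unit_circle_def eventually_filtercomap)
  then show "\<exists>b<1. \<forall>z. b < norm z \<and> norm z < 1 \<longrightarrow> P z"
    by (auto simp: eventually_at_left[of 0 1])
next
  assume "\<exists>b<1. \<forall>z. b < norm z \<and> norm z < 1 \<longrightarrow> P z"
  then obtain b where b: "b < 1" "\<And>z. b < norm z \<Longrightarrow> norm z < 1 \<Longrightarrow> P z" by blast
  have "eventually (\<lambda>x. b < x \<and> x < 1) (at_left (1::real))"
    using b(1) by (auto simp: eventually_at_left[of 0 1])
  then show "eventually P to_unit_circle"
    using b(2) by (auto simp: to_unit_circle_def eventually_filtercomap)
qed

lemma eventually_to_unit_circle_norm_gt: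
  "\<rho> < 1 \<Longrightarrow> eventually (\<lambda>z. z \<in> unit_disk \<and> \<rho> < norm z) to_unit_circle"
  by (auto simp: eventually_to_unit_circle)

lemma tendsto_0_to_unit_circle_iff:
  fixes h :: "complex \<Rightarrow> real"
  shows "(h \<longlongrightarrow> 0) to_unit_circle
    \<longleftrightarrow> (\<forall>\<epsilon>>0. \<exists>\<rho><1. \<forall>z. \<rho> < norm z \<and> norm z < 1 \<longrightarrow> \<bar>h z\<bar> < \<epsilon>)"
  by (simp add: tendsto_iff eventually_to_unit_circle)

section \<open>Derivatives of Bergman functions\<close>

lemma H_disk_borel_measurable: "f \<in> H_disk \<Longrightarrow> f \<in> borel_measurable borel"
proof -
  assume f: "f \<in> H_disk"
  then have "(\<lambda>z. indicator unit_disk z *\<^sub>R f z) \<in> borel_measurable borel"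
    by (intro borel_measurable_continuous_on_indicator holomorphic_on_imp_continuous_on)
       (auto simp: H_disk_def)
  moreover have "(\<lambda>z. indicator unit_disk z *\<^sub>R f z) = f"
    using f by (auto simp: H_disk_def indicator_def fun_eq_iff)
  ultimately show ?thesis by simp
qed

text \<open>
  Rewriting the area measure as a density turns integrals against it into Lebesgue integrals over
  the disk, divided by \<open>\<pi>\<close>.
\<close>
lemma disk_area_eq_density:
  "disk_area = density lborel (\<lambda>z. ennreal (indicator unit_disk z / pi))"
  unfolding disk_area_def uniform_measure_def
  by (intro density_cong)
     (auto simp: emeasure_ball_complex indicator_def divide_ennreal[symmetric])

lemma
  fixes g :: "complex \<Rightarrow> real"
  assumes g: "g \<in> borel_measurable borel"
  shows integrable_disk_area_iff: "integrable disk_area g \<longleftrightarrow> set_integrable lborel unit_disk g"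
    and integral_disk_area: "integral\<^sup>L disk_area g = (LINT z:unit_disk|lborel. g z) / pi"
proof -
  have eq: "(indicator unit_disk z / pi) *\<^sub>R g z = inverse pi * (indicator unit_disk z *\<^sub>R g z)" for z
    by (simp add: field_simps)
  have meas: "(\<lambda>z. indicat_real unit_disk z / pi) \<in> borel_measurable lborel"
    by (intro borel_measurable_divide borel_measurable_indicator) auto
  have "integrable disk_area g
      \<longleftrightarrow> integrable lborel (\<lambda>z. (indicator unit_disk z / pi) *\<^sub>R g z)"
    unfolding disk_area_eq_density using g meas by (intro integrable_density) auto
  then show "integrable disk_area g \<longleftrightarrow> set_integrable lborel unit_disk g"
    unfolding eq set_integrable_def by simp
  have "integral\<^sup>L disk_area g
      = (\<integral>z. (indicator unit_disk z / pi) *\<^sub>R g z \<partial>lborel)"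
    unfolding disk_area_eq_density using g meas by (intro integral_density) auto
  then show "integral\<^sup>L disk_area g = (LINT z:unit_disk|lborel. g z) / pi"
    unfolding eq set_lebesgue_integral_def by (simp only: integral_mult_right_zero) (simp add: field_simps)
qed

lemma norm_powr_borel_measurable:
  "f \<in> H_disk \<Longrightarrow> (\<lambda>z. norm (f z) powr p) \<in> borel_measurable borel"
  using H_disk_borel_measurable[of f] by measurable

lemma bergman_iff:
  "f \<in> bergman p \<longleftrightarrow> f \<in> H_disk \<and> set_integrable lborel unit_disk (\<lambda>z. norm (f z) powr p)"
  by (auto simp: bergman_def integrable_disk_area_iff norm_powr_borel_measurable)

lemma bergman_imp_H_disk: "f \<in> bergman p \<Longrightarrow> f \<in> H_disk"
  by (simp add: bergman_def)

lemma H_disk_holomorphic_on_ball: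
  assumes "f \<in> H_disk" "w \<in> unit_disk"
  shows "f holomorphic_on ball w (1 - norm w)"
proof -
  have "ball w (1 - norm w) \<subseteq> unit_disk"
  proof
    fix y assume "y \<in> ball w (1 - norm w)"
    then show "y \<in> unit_disk" using dist_triangle[of 0 y w] by (simp add: dist_norm)
  qed
  then show ?thesis
    using assms by (auto simp: H_disk_def intro: holomorphic_on_subset)
qed

lemma bergman_integral_powr:
  assumes f: "f \<in> bergman p"
  shows "(LINT z:unit_disk|lborel. norm (f z) powr p) powr (1 / p) = pi powr (1 / p) * bergman_norm p f"
proof -
  have nn: "0 \<le> (LINT z:unit_disk|lborel. norm (f z) powr p)"
    unfolding set_lebesgue_integral_def by (intro integral_nonneg_AE) auto
  have "bergman_norm p f = ((LINT z:unit_disk|lborel. norm (f z) powr p) / pi) powr (1 / p)"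
    unfolding bergman_norm_def
    using integral_disk_area[OF norm_powr_borel_measurable[OF bergman_imp_H_disk[OF f]]] by simp
  then show ?thesis using nn by (simp add: powr_divide)
qed

text \<open>
  The sub-mean value inequality on the ball of radius \<open>(1 - |w|)/2\<close>. It bounds norm-bounded families
  locally uniformly, as Montel's theorem requires.
\<close>
lemma bergman_growth:
  assumes p: "0 < p"
  obtains K where "0 < K"
    and "\<And>f w. f \<in> bergman p \<Longrightarrow> w \<in> unit_disk
           \<Longrightarrow> (1 - norm w) powr (2 / p) * norm (f w) \<le> K * bergman_norm p f"
proof -
  obtain C where C: "0 < C" and sub: "\<And>(f::complex \<Rightarrow> complex) z r R. f holomorphic_on ball z R \<Longrightarrow> 0 < r \<Longrightarrow> r < R \<Longrightarrow>
           norm (f z) powr p * r\<^sup>2 \<le> C * (LINT w:ball z r|lborel. norm (f w) powr p)"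
    using sub_mean_value_powr[OF p] by blast
  show ?thesis
  proof
    show "0 < (4 * C * pi) powr (1 / p)" using C by simp
    fix f w assume f: "f \<in> bergman p" and w: "w \<in> unit_disk"
    define r where "r = (1 - norm w) / 2"
    define I where "I = (LINT z:unit_disk|lborel. norm (f z) powr p)"
    have r: "0 < r" "r < 1 - norm w" "1 - norm w = 2 * r" using w by (auto simp: r_def)
    have I0: "0 \<le> I" unfolding I_def set_lebesgue_integral_def by (intro integral_nonneg_AE) auto
    have "norm (f w) powr p * r\<^sup>2 \<le> C * (LINT z:ball w r|lborel. norm (f z) powr p)"
      using sub[OF H_disk_holomorphic_on_ball[OF bergman_imp_H_disk[OF f] w] r(1,2)] .
    also have "\<dots> \<le> C * I"
      unfolding I_def
    proof (intro mult_left_mono set_integral_mono_domain)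
      show "ball w r \<subseteq> unit_disk"
      proof
        fix y assume "y \<in> ball w r"
        then show "y \<in> unit_disk" using dist_triangle[of 0 y w] r by (simp add: dist_norm)
      qed
    qed (use f C in \<open>auto simp: bergman_iff\<close>)
    finally have "(1 - norm w)\<^sup>2 * norm (f w) powr p \<le> 4 * C * I"
      unfolding r(3) by (simp add: power2_eq_square mult_ac)
    then have "((1 - norm w)\<^sup>2 * norm (f w) powr p) powr (1 / p) \<le> (4 * C * I) powr (1 / p)"
      using p by (intro powr_mono2) auto
    also have "((1 - norm w)\<^sup>2 * norm (f w) powr p) powr (1 / p) = (1 - norm w) powr (2 / p) * norm (f w)"
    proof -
      have "(1 - norm w)\<^sup>2 = (1 - norm w) powr 2" using w by simp
      then show ?thesis using p by (simp only: powr_mult powr_powr) simp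
    qed
    also have "(4 * C * I) powr (1 / p) = (4 * C * pi) powr (1 / p) * bergman_norm p f"
      using C I0 bergman_integral_powr[OF f] by (simp add: powr_mult I_def)
    finally show "(1 - norm w) powr (2 / p) * norm (f w) \<le> (4 * C * pi) powr (1 / p) * bergman_norm p f" .
  qed
qed

text \<open>
  The integral is kept local: comparing it with the whole disk yields the norm bound, and comparing
  it with a thin annulus yields the decay at the circle. The radius \<open>r = (1 - |w|)/4\<close> in
  \<open>deriv_sub_mean_value_powr\<close> satisfies \<open>1 - |w|\<^sup>2 \<le> 8r\<close>.
\<close>
lemma bergman_deriv_local:
  assumes p: "0 < p"
  obtains K where "0 < K"
    and "\<And>f w. f \<in> bergman p \<Longrightarrow> w \<in> unit_disk
           \<Longrightarrow> (1 - (norm w)\<^sup>2) powr (1 + 2 / p) * norm (deriv f w)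
               \<le> K * (LINT z:ball w ((1 - norm w) / 2)|lborel. norm (f z) powr p) powr (1 / p)"
proof -
  obtain C where C: "0 < C"
    and sub: "\<And>(f::complex \<Rightarrow> complex) z r R. f holomorphic_on ball z R \<Longrightarrow> 0 < r \<Longrightarrow> 2 * r < R \<Longrightarrow>
           r powr (1 + 2 / p) * norm (deriv f z)
             \<le> C * (LINT w:ball z (2 * r)|lborel. norm (f w) powr p) powr (1 / p)"
    using deriv_sub_mean_value_powr[OF p] by blast
  show ?thesis
  proof
    show "0 < 8 powr (1 + 2 / p) * C" using C by simp
    fix f w assume f: "f \<in> bergman p" and w: "w \<in> unit_disk"
    define r where "r = (1 - norm w) / 4"
    have r: "0 < r" "2 * r < 1 - norm w" "2 * r = (1 - norm w) / 2" using w by (auto simp: r_def)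
    have "1 - (norm w)\<^sup>2 = (1 + norm w) * (1 - norm w)" by (simp add: power2_eq_square algebra_simps)
    also have "\<dots> \<le> 2 * (1 - norm w)" using w by (intro mult_right_mono) auto
    finally have "1 - (norm w)\<^sup>2 \<le> 8 * r" by (simp add: r_def)
    then have "(1 - (norm w)\<^sup>2) powr (1 + 2 / p) \<le> (8 * r) powr (1 + 2 / p)"
      using w p by (intro powr_mono2) (auto simp: abs_square_le_1)
    then have "(1 - (norm w)\<^sup>2) powr (1 + 2 / p) * norm (deriv f w)
        \<le> 8 powr (1 + 2 / p) * (r powr (1 + 2 / p) * norm (deriv f w))"
      using r by (simp add: powr_mult mult_right_mono flip: mult.assoc)
    also have "\<dots> \<le> 8 powr (1 + 2 / p)
        * (C * (LINT z:ball w (2 * r)|lborel. norm (f z) powr p) powr (1 / p))"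
      by (intro mult_left_mono sub[OF H_disk_holomorphic_on_ball[OF bergman_imp_H_disk[OF f] w] r(1,2)]) auto
    finally show "(1 - (norm w)\<^sup>2) powr (1 + 2 / p) * norm (deriv f w)
        \<le> 8 powr (1 + 2 / p) * C * (LINT z:ball w ((1 - norm w) / 2)|lborel. norm (f z) powr p) powr (1 / p)"
      unfolding r(3) by (simp only: mult.assoc)
  qed
qed

lemma ball_half_subset_annulus:
  fixes w :: complex
  assumes "w \<in> unit_disk"
  shows "ball w ((1 - norm w) / 2) \<subseteq> {z. 1 - 2 * (1 - norm w) < norm z} \<inter> unit_disk"
proof
  fix y assume "y \<in> ball w ((1 - norm w) / 2)"
  then show "y \<in> {z. 1 - 2 * (1 - norm w) < norm z} \<inter> unit_disk"
    using assms dist_triangle[of 0 y w] dist_triangle[of 0 w y] by (simp add: dist_norm norm_minus_commute)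
qed

lemma bergman_deriv_bound:
  assumes p: "0 < p"
  obtains K where "0 < K"
    and "\<And>f w. f \<in> bergman p \<Longrightarrow> w \<in> unit_disk
           \<Longrightarrow> (1 - (norm w)\<^sup>2) powr (1 + 2 / p) * norm (deriv f w) \<le> K * bergman_norm p f"
proof -
  obtain K where K: "0 < K" and loc: "\<And>f w. f \<in> bergman p \<Longrightarrow> w \<in> unit_disk
           \<Longrightarrow> (1 - (norm w)\<^sup>2) powr (1 + 2 / p) * norm (deriv f w)
               \<le> K * (LINT z:ball w ((1 - norm w) / 2)|lborel. norm (f z) powr p) powr (1 / p)"
    using bergman_deriv_local[OF p] by blast
  show ?thesis
  proof
    show "0 < K * pi powr (1 / p)" using K by simp
    fix f w assume f: "f \<in> bergman p" and w: "w \<in> unit_disk"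
    have "(LINT z:ball w ((1 - norm w) / 2)|lborel. norm (f z) powr p)
        \<le> (LINT z:unit_disk|lborel. norm (f z) powr p)"
      using f ball_half_subset_annulus[OF w]
      by (intro set_integral_mono_domain) (auto simp: bergman_iff)
    then have "(LINT z:ball w ((1 - norm w) / 2)|lborel. norm (f z) powr p) powr (1 / p)
        \<le> pi powr (1 / p) * bergman_norm p f"
      unfolding bergman_integral_powr[OF f, symmetric] using p
      by (intro powr_mono2) (auto simp: set_lebesgue_integral_def intro!: integral_nonneg_AE)
    then show "(1 - (norm w)\<^sup>2) powr (1 + 2 / p) * norm (deriv f w) \<le> K * pi powr (1 / p) * bergman_norm p f"
      using loc[OF f w] K by (smt (verit) mult.assoc mult_left_mono)
  qed
qed

text \<open>
  The balls of \<open>bergman_deriv_local\<close> lie in annuli shrinking to the circle, over which the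
  integral of \<open>|f|\<^sup>p\<close> tends to 0 by dominated convergence.
\<close>
lemma bergman_deriv_tendsto_0:
  assumes p: "0 < p" and f: "f \<in> bergman p"
  shows "((\<lambda>w. (1 - (norm w)\<^sup>2) powr (1 + 2 / p) * norm (deriv f w)) \<longlongrightarrow> 0) to_unit_circle"
  unfolding tendsto_0_to_unit_circle_iff
proof (intro allI impI)
  fix \<epsilon> :: real assume \<epsilon>: "0 < \<epsilon>"
  obtain K where K: "0 < K" and loc: "\<And>f w. f \<in> bergman p \<Longrightarrow> w \<in> unit_disk
           \<Longrightarrow> (1 - (norm w)\<^sup>2) powr (1 + 2 / p) * norm (deriv f w)
               \<le> K * (LINT z:ball w ((1 - norm w) / 2)|lborel. norm (f z) powr p) powr (1 / p)"
    using bergman_deriv_local[OF p] by blast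
  let ?A = "\<lambda>n::nat. {z::complex. 1 - 1 / Suc n < norm z} \<inter> unit_disk"
  have meas: "?A n \<in> sets lborel" for n
    by simp
  have int: "set_integrable lborel unit_disk (\<lambda>z. norm (f z) powr p)"
    using f by (simp add: bergman_iff)
  have intA: "set_integrable lborel (?A n) (\<lambda>z. norm (f z) powr p)" for n
    using int meas by (rule set_integrable_subset) auto
  have "(\<lambda>n. LINT z:?A n|lborel. norm (f z) powr p) \<longlonglongrightarrow> (\<integral>z. 0 \<partial>(lborel::complex measure))"
    unfolding set_lebesgue_integral_def
  proof (rule integral_dominated_convergence)
    show "integrable lborel (\<lambda>z. indicator unit_disk z *\<^sub>R norm (f z) powr p)"
      using int by (simp add: set_integrable_def)
    show "(\<lambda>z. indicator (?A n) z *\<^sub>R norm (f z) powr p) \<in> borel_measurable lborel" for n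
      using intA[of n] by (simp add: set_integrable_def borel_measurable_integrable)
    show "AE z in lborel. norm (indicator (?A n) z *\<^sub>R norm (f z) powr p)
        \<le> indicator unit_disk z *\<^sub>R norm (f z) powr p" for n
      by (auto simp: indicator_def)
    show "AE z in lborel. (\<lambda>n. indicator (?A n) z *\<^sub>R norm (f z) powr p) \<longlonglongrightarrow> 0"
    proof (intro always_eventually allI)
      fix z :: complex
      show "(\<lambda>n. indicator (?A n) z *\<^sub>R norm (f z) powr p) \<longlonglongrightarrow> 0"
      proof (cases "norm z < 1")
        case True
        have "(\<lambda>n. 1 / real (Suc n)) \<longlonglongrightarrow> 0"
          using LIMSEQ_inverse_real_of_nat by (simp add: inverse_eq_divide)
        then have "eventually (\<lambda>n. 1 / real (Suc n) < 1 - norm z) sequentially"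
          using True by (intro order_tendstoD) auto
        then have "eventually (\<lambda>n. indicator (?A n) z *\<^sub>R norm (f z) powr p = 0) sequentially"
          by eventually_elim (auto simp: indicator_def)
        then show ?thesis by (rule tendsto_eventually)
      qed (simp add: indicator_def)
    qed
  qed simp
  then have "(\<lambda>n. LINT z:?A n|lborel. norm (f z) powr p) \<longlonglongrightarrow> 0" by simp
  then have "eventually (\<lambda>n. (LINT z:?A n|lborel. norm (f z) powr p) < (\<epsilon> / K) powr p) sequentially"
    using \<epsilon> K by (intro order_tendstoD) auto
  then obtain n where n: "(LINT z:?A n|lborel. norm (f z) powr p) < (\<epsilon> / K) powr p"
    by (auto simp: eventually_sequentially)
  show "\<exists>\<rho><1. \<forall>w. \<rho> < norm w \<and> norm w < 1 \<longrightarrow>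
      \<bar>(1 - (norm w)\<^sup>2) powr (1 + 2 / p) * norm (deriv f w)\<bar> < \<epsilon>"
  proof (intro exI[of _ "1 - 1 / (2 * real (Suc n))"] conjI allI impI)
    fix w :: complex assume w: "1 - 1 / (2 * real (Suc n)) < norm w \<and> norm w < 1"
    then have wd: "w \<in> unit_disk" by simp
    have "2 * (1 - norm w) < 1 / real (Suc n)" using w by (simp add: field_simps)
    then have "ball w ((1 - norm w) / 2) \<subseteq> ?A n"
      using ball_half_subset_annulus[OF wd] by auto
    then have "(LINT z:ball w ((1 - norm w) / 2)|lborel. norm (f z) powr p)
        \<le> (LINT z:?A n|lborel. norm (f z) powr p)"
      by (intro set_integral_mono_domain[OF intA]) auto
    then have "(LINT z:ball w ((1 - norm w) / 2)|lborel. norm (f z) powr p) < (\<epsilon> / K) powr p"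
      using n by simp
    then have "(LINT z:ball w ((1 - norm w) / 2)|lborel. norm (f z) powr p) powr (1 / p)
        < ((\<epsilon> / K) powr p) powr (1 / p)"
      using p by (intro powr_less_mono2) (auto simp: set_lebesgue_integral_def intro!: integral_nonneg_AE)
    also have "\<dots> = \<epsilon> / K" using p \<epsilon> K by (simp add: powr_powr)
    finally have "K * (LINT z:ball w ((1 - norm w) / 2)|lborel. norm (f z) powr p) powr (1 / p) < \<epsilon>"
      using K by (simp add: field_simps)
    then show "\<bar>(1 - (norm w)\<^sup>2) powr (1 + 2 / p) * norm (deriv f w)\<bar> < \<epsilon>"
      using loc[OF f wd] by simp
  qed simp
qed

section \<open>Test functions peaking at a given point\<close>

text \<open>
  If \<open>2\<^sup>k \<delta> \<le> x < 2\<^sup>k\<^sup>+\<^sup>1 \<delta>\<close>, the \<open>k\<close>-th term alone dominates.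
\<close>
lemma inverse_power4_le_dyadic_sum:
  fixes \<delta> x :: real
  assumes "0 < \<delta>" "\<delta> \<le> x"
  shows "ennreal (1 / x ^ 4)
    \<le> (\<Sum>k. ennreal (1 / (2 ^ k * \<delta>) ^ 4) * indicator {..<2 ^ Suc k * \<delta>} x)"
proof -
  obtain n :: nat where "x / \<delta> < 2 ^ n" using real_arch_pow[of 2 "x / \<delta>"] by auto
  then have ex: "x < 2 ^ n * \<delta>" using assms by (simp add: field_simps)
  \<comment> \<open>minimality gives the lower bound \<open>2\<^sup>k \<delta> \<le> x\<close>; for \<open>k = 0\<close> it is the hypothesis\<close>
  define k where "k = (LEAST k. x < 2 ^ Suc k * \<delta>)"
  have "x < 2 ^ Suc n * \<delta>" using ex assms by (simp add: order.strict_trans2)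
  then have k: "x < 2 ^ Suc k * \<delta>" unfolding k_def by (rule LeastI)
  have "2 ^ k * \<delta> \<le> x"
  proof (cases k)
    case (Suc j)
    then have "\<not> x < 2 ^ Suc j * \<delta>" unfolding k_def by (intro not_less_Least) simp
    then show ?thesis using Suc by simp
  qed (use assms in simp)
  then have "(2 ^ k * \<delta>) ^ 4 \<le> x ^ 4" using assms by (intro power_mono) auto
  then have "1 / x ^ 4 \<le> 1 / (2 ^ k * \<delta>) ^ 4"
    using assms by (intro divide_left_mono) auto
  define F where "F = (\<lambda>k. ennreal (1 / (2 ^ k * \<delta>) ^ 4) * indicator {..<2 ^ Suc k * \<delta>} x)"
  have "ennreal (1 / x ^ 4) \<le> F k"
    using k \<open>1 / x ^ 4 \<le> 1 / (2 ^ k * \<delta>) ^ 4\<close> by (auto simp: F_def intro: ennreal_leI)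
  also have "\<dots> \<le> suminf F"
    using sum_le_suminf[of F "{k}"] by simp
  finally show ?thesis by (simp only: F_def)
qed

lemma norm_one_minus_cnj_mult_ge:
  assumes "z \<in> unit_disk"
  shows "1 - norm a \<le> norm (1 - cnj a * z)"
proof -
  have "norm (cnj a * z) \<le> norm a * 1"
    using assms by (simp add: norm_mult mult_left_le)
  then show ?thesis using norm_triangle_ineq2[of 1 "cnj a * z"] by simp
qed

text \<open>
  The sets \<open>|1 - cnj a \<cdot> z| < s\<close> are balls of radius \<open>s/|a| \<le> 2s\<close>, so the dyadic pieces of
  \<open>inverse_power4_le_dyadic_sum\<close> contribute a geometric series. The square of
  \<open>1 - |a|\<close> is the true order of growth.
\<close>
lemma nn_integral_kernel_power4:
  assumes a: "a \<in> unit_disk" "1 / 2 \<le> norm a"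
  shows "(\<integral>\<^sup>+z. ennreal (1 / norm (1 - cnj a * z) ^ 4) * indicator unit_disk z \<partial>lborel)
    \<le> ennreal (64 / 3 * pi / (1 - norm a)\<^sup>2)"
proof -
  define \<delta> where "\<delta> = 1 - norm a"
  have \<delta>: "0 < \<delta>" using a by (simp add: \<delta>_def)
  have a0: "a \<noteq> 0" using a by auto
  let ?b = "\<lambda>k. ball (1 / cnj a) (2 ^ Suc k * \<delta> / norm a)"
  have [measurable]: "?b k \<in> sets borel" for k
    by simp
  have ball: "norm (1 - cnj a * z) < s \<longleftrightarrow> z \<in> ball (1 / cnj a) (s / norm a)" for z s
  proof -
    have "norm (1 - cnj a * z) = norm a * dist (1 / cnj a) z"
    proof -
      have "1 - cnj a * z = cnj a * (1 / cnj a - z)" using a0 by (simp add: field_simps)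
      then show ?thesis by (simp only: norm_mult dist_norm complex_mod_cnj)
    qed
    then show ?thesis using a0 by (simp add: field_simps)
  qed
  have "(\<integral>\<^sup>+z. ennreal (1 / norm (1 - cnj a * z) ^ 4) * indicator unit_disk z \<partial>lborel)
      \<le> (\<integral>\<^sup>+z. (\<Sum>k. ennreal (1 / (2 ^ k * \<delta>) ^ 4) * indicator (?b k) z) \<partial>lborel)"
  proof (intro nn_integral_mono)
    fix z :: complex
    show "ennreal (1 / norm (1 - cnj a * z) ^ 4) * indicator unit_disk z
      \<le> (\<Sum>k. ennreal (1 / (2 ^ k * \<delta>) ^ 4) * indicator (?b k) z)"
    proof (cases "z \<in> unit_disk")
      case True
      have "ennreal (1 / norm (1 - cnj a * z) ^ 4)
        \<le> (\<Sum>k. ennreal (1 / (2 ^ k * \<delta>) ^ 4) * indicator {..<2 ^ Suc k * \<delta>} (norm (1 - cnj a * z)))"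
        using norm_one_minus_cnj_mult_ge[OF True, of a]
        by (intro inverse_power4_le_dyadic_sum \<delta>) (simp add: \<delta>_def)
      also have "\<dots> = (\<Sum>k. ennreal (1 / (2 ^ k * \<delta>) ^ 4) * indicator (?b k) z)"
        unfolding indicator_def lessThan_iff ball ..
      finally show ?thesis using True by simp
    qed simp
  qed
  also have "\<dots> = (\<Sum>k. \<integral>\<^sup>+z. ennreal (1 / (2 ^ k * \<delta>) ^ 4) * indicator (?b k) z \<partial>lborel)"
    by (intro nn_integral_suminf) measurable
  also have "\<dots> \<le> (\<Sum>k. ennreal (16 * pi / \<delta>\<^sup>2 * (1 / 4) ^ k))"
  proof (intro suminf_le allI summableI)
    fix k
    have "(\<integral>\<^sup>+z. ennreal (1 / (2 ^ k * \<delta>) ^ 4) * indicator (?b k) z \<partial>lborel)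
        = ennreal (1 / (2 ^ k * \<delta>) ^ 4) * ennreal (pi * (2 ^ Suc k * \<delta> / norm a)\<^sup>2)"
      using \<delta> by (subst nn_integral_cmult_indicator) (auto simp: emeasure_ball_complex)
    also have "\<dots> = ennreal (1 / (2 ^ k * \<delta>) ^ 4 * (pi * (2 ^ Suc k * \<delta> / norm a)\<^sup>2))"
      using \<delta> by (intro ennreal_mult[symmetric]) auto
    also have "\<dots> \<le> ennreal (1 / (2 ^ k * \<delta>) ^ 4 * (pi * (2 ^ Suc k * \<delta> * 2)\<^sup>2))"
    proof (intro ennreal_leI mult_left_mono power_mono)
      have "1 / norm a \<le> 2" using a(2) a0 by (simp add: field_simps)
      then have "2 ^ Suc k * \<delta> * (1 / norm a) \<le> 2 ^ Suc k * \<delta> * 2"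
        using \<delta> by (intro mult_left_mono) auto
      then show "2 ^ Suc k * \<delta> / norm a \<le> 2 ^ Suc k * \<delta> * 2" by simp
    qed (use \<delta> in auto)
    also have "1 / (2 ^ k * \<delta>) ^ 4 * (pi * (2 ^ Suc k * \<delta> * 2)\<^sup>2) = 16 * pi / \<delta>\<^sup>2 * (1 / 4) ^ k"
    proof -
      define t :: real where "t = 2 ^ k"
      have "t > 0" by (simp add: t_def)
      have "(1 / 4 :: real) ^ k = 1 / t\<^sup>2"
        by (simp add: t_def power_divide power_mult[symmetric] mult.commute[of k])
           (simp add: power_mult)
      then show ?thesis
        using \<delta> \<open>t > 0\<close> unfolding power_Suc t_def[symmetric]
        by (simp add: field_simps power2_eq_square power4_eq_xxxx)
    qed
    finally show "(\<integral>\<^sup>+z. ennreal (1 / (2 ^ k * \<delta>) ^ 4) * indicator (?b k) z \<partial>lborel)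
        \<le> ennreal (16 * pi / \<delta>\<^sup>2 * (1 / 4) ^ k)" .
  qed
  also have "\<dots> = ennreal (16 * pi / \<delta>\<^sup>2 * (4 / 3))"
  proof (rule suminf_ennreal_eq)
    have "(\<lambda>k. (1 / 4 :: real) ^ k) sums (4 / 3)" using geometric_sums[of "1 / 4 :: real"] by simp
    then show "(\<lambda>k. 16 * pi / \<delta>\<^sup>2 * (1 / 4) ^ k) sums (16 * pi / \<delta>\<^sup>2 * (4 / 3))"
      by (rule sums_mult)
  qed auto
  finally show ?thesis by (simp add: \<delta>_def mult_ac)
qed

text \<open>
  The power of \<open>1 - |a|\<^sup>2\<close> normalises the Bergman norm. The integer exponent \<open>N\<close> makes holomorphy
  evident; if \<open>N p \<ge> 4\<close>, the norm estimate reduces to \<open>nn_integral_kernel_power4\<close>.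
\<close>
definition peak_function :: "real \<Rightarrow> nat \<Rightarrow> complex \<Rightarrow> complex \<Rightarrow> complex"
  where "peak_function p N a z = (if z \<in> unit_disk
    then of_real ((1 - (norm a)\<^sup>2) powr (N - 2 / p)) / (1 - cnj a * z) ^ N else 0)"

lemma one_minus_cnj_mult_nonzero:
  assumes "a \<in> unit_disk" "z \<in> unit_disk"
  shows "1 - cnj a * z \<noteq> 0"
  using norm_one_minus_cnj_mult_ge[OF assms(2), of a] assms(1) by auto

lemma peak_function_H_disk:
  assumes "a \<in> unit_disk"
  shows "peak_function p N a \<in> H_disk"
proof -
  have "(\<lambda>z. of_real ((1 - (norm a)\<^sup>2) powr (N - 2 / p)) / (1 - cnj a * z) ^ N) holomorphic_on unit_disk"
    using one_minus_cnj_mult_nonzero[OF assms] by (intro holomorphic_intros) auto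
  then have "peak_function p N a holomorphic_on unit_disk"
    by (rule holomorphic_transform) (simp add: peak_function_def)
  then show ?thesis by (simp add: H_disk_def peak_function_def)
qed

lemma one_minus_norm_sq_bounds:
  assumes "a \<in> unit_disk"
  shows "0 < 1 - (norm a)\<^sup>2" "1 - (norm a)\<^sup>2 \<le> 1" "1 - (norm a)\<^sup>2 \<le> 2 * (1 - norm a)"
proof -
  have eq: "1 - (norm a)\<^sup>2 = (1 + norm a) * (1 - norm a)" by (simp add: power2_eq_square algebra_simps)
  show "0 < 1 - (norm a)\<^sup>2" unfolding eq using assms by (intro mult_pos_pos add_pos_nonneg) auto
  show "1 - (norm a)\<^sup>2 \<le> 2 * (1 - norm a)"
    unfolding eq using assms by (intro mult_right_mono) auto
qed simp

lemma norm_deriv_peak_function_self: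
  assumes a: "a \<in> unit_disk"
  shows "norm (deriv (peak_function p N a) a) = N * norm a * (1 - (norm a)\<^sup>2) powr (- (1 + 2 / p))"
proof (cases N)
  case 0
  have "(peak_function p N a has_field_derivative 0) (at a)"
    by (rule has_field_derivative_transform_within_open[OF DERIV_const
      [of "of_real ((1 - (norm a)\<^sup>2) powr (- 2 / p))"] open_ball a]) (simp add: peak_function_def 0)
  then show ?thesis by (simp add: DERIV_imp_deriv 0)
next
  case (Suc M)
  define s where "s = 1 - (norm a)\<^sup>2"
  have s: "0 < s" using one_minus_norm_sq_bounds[OF a] by (simp add: s_def)
  define c where "c = s powr (N - 2 / p)"
  have sa: "1 - cnj a * a = of_real s"
    by (simp add: s_def mult.commute[of "cnj a"] complex_norm_square[symmetric])
  have "((\<lambda>z. of_real c / (1 - cnj a * z) ^ N) has_field_derivative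
      (of_real c * of_nat N * cnj a / (of_real s) ^ Suc N)) (at a)"
    using s unfolding Suc
    by (auto intro!: derivative_eq_intros simp del: of_nat_Suc simp: sa)
       (cases M; simp add: field_simps power2_eq_square)
  then have "(peak_function p N a has_field_derivative
      (of_real c * of_nat N * cnj a / (of_real s) ^ Suc N)) (at a)"
    by (rule has_field_derivative_transform_within_open[OF _ open_ball a])
       (simp add: peak_function_def c_def s_def)
  then have "deriv (peak_function p N a) a = of_real c * of_nat N * cnj a / (of_real s) ^ Suc N"
    by (rule DERIV_imp_deriv)
  then have "norm (deriv (peak_function p N a) a) = c * N * norm a / s ^ Suc N"
    using s by (simp add: norm_mult norm_divide norm_power c_def del: of_nat_Suc)
  also have "\<dots> = N * norm a * (c / s ^ Suc N)" by simp
  also have "c / s ^ Suc N = s powr (- (1 + 2 / p))"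
  proof -
    have "s ^ Suc N = s powr (real (Suc N))" using s by (rule powr_realpow[symmetric])
    then have "c / s ^ Suc N = s powr ((N - 2 / p) - Suc N)"
      by (simp only: c_def powr_diff)
    also have "(N - 2 / p) - Suc N = - (1 + 2 / p)" by simp
    finally show ?thesis .
  qed
  finally show ?thesis by (simp add: s_def)
qed

text \<open>
  As \<open>|1 - cnj a \<cdot> z| \<ge> (1 - |a|\<^sup>2)/2\<close>, all but the fourth power of the denominator can be traded
  for powers of \<open>1 - |a|\<^sup>2\<close>.
\<close>
lemma peak_function_powr_le:
  assumes a: "a \<in> unit_disk" and z: "z \<in> unit_disk" and p: "0 < p" and N: "4 \<le> N * p"
  shows "norm (peak_function p N a z) powr p
      \<le> 2 powr (N * p - 4) * (1 - (norm a)\<^sup>2)\<^sup>2 * (1 / norm (1 - cnj a * z) ^ 4)"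
proof -
  define s where "s = 1 - (norm a)\<^sup>2"
  define x where "x = norm (1 - cnj a * z)"
  have s: "0 < s" "s / 2 \<le> 1 - norm a" using one_minus_norm_sq_bounds[OF a] by (auto simp: s_def)
  then have x: "s / 2 \<le> x" using norm_one_minus_cnj_mult_ge[OF z, of a] by (simp add: x_def)
  then have x0: "0 < x" using s by linarith
  have "norm (peak_function p N a z) = s powr (N - 2 / p) / x powr N"
    using z x0 s by (simp add: peak_function_def s_def x_def norm_divide norm_power powr_realpow)
  then have "norm (peak_function p N a z) powr p = s powr ((N - 2 / p) * p) / x powr (N * p)"
    by (simp add: powr_divide powr_powr)
  also have "(N - 2 / p) * p = (N * p - 4) + 2" using p by (simp add: field_simps)
  also have "s powr ((N * p - 4) + 2) = s powr (N * p - 4) * s\<^sup>2" unfolding powr_add using s by simp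
  also have "x powr (N * p) = x powr (N * p - 4) * x ^ 4"
    using x0 by (simp add: powr_diff)
  also have "s powr (N * p - 4) * s\<^sup>2 / (x powr (N * p - 4) * x ^ 4)
      = (s powr (N * p - 4) / x powr (N * p - 4)) * s\<^sup>2 * (1 / x ^ 4)"
    by simp
  also have "s powr (N * p - 4) / x powr (N * p - 4) = (s / x) powr (N * p - 4)"
    using s x0 by (simp add: powr_divide)
  also have "(s / x) powr (N * p - 4) * s\<^sup>2 * (1 / x ^ 4) \<le> 2 powr (N * p - 4) * s\<^sup>2 * (1 / x ^ 4)"
    using x x0 s N by (intro mult_right_mono powr_mono2) (auto simp: field_simps)
  finally show ?thesis by (simp add: s_def x_def)
qed

lemma peak_function_bergman:
  assumes p: "0 < p" and N: "4 \<le> N * p" and a: "a \<in> unit_disk" "1 / 2 \<le> norm a"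
  shows "peak_function p N a \<in> bergman p"
    and "bergman_norm p (peak_function p N a) \<le> (2 powr (N * p - 4) * (256 / 3)) powr (1 / p)"
proof -
  let ?f = "peak_function p N a"
  have [measurable]: "unit_disk \<in> sets borel" by simp
  define c where "c = 2 powr (N * p - 4) * (1 - (norm a)\<^sup>2)\<^sup>2"
  define B where "B = 2 powr (N * p - 4) * (256 / 3 * pi)"
  have H: "?f \<in> H_disk" by (rule peak_function_H_disk[OF a(1)])
  have bound: "(\<integral>\<^sup>+z. ennreal (indicator unit_disk z *\<^sub>R norm (?f z) powr p) \<partial>lborel) \<le> ennreal B"
  proof -
    have "(\<integral>\<^sup>+z. ennreal (indicator unit_disk z *\<^sub>R norm (?f z) powr p) \<partial>lborel)
        \<le> (\<integral>\<^sup>+z. ennreal c * (ennreal (1 / norm (1 - cnj a * z) ^ 4) * indicator unit_disk z) \<partial>lborel)"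
    proof (intro nn_integral_mono)
      fix z :: complex
      show "ennreal (indicator unit_disk z *\<^sub>R norm (?f z) powr p)
          \<le> ennreal c * (ennreal (1 / norm (1 - cnj a * z) ^ 4) * indicator unit_disk z)"
        using peak_function_powr_le[OF a(1) _ p N, of z]
        by (cases "z \<in> unit_disk") (auto simp: c_def ennreal_mult[symmetric] intro!: ennreal_leI)
    qed
    also have "\<dots> = ennreal c * (\<integral>\<^sup>+z. ennreal (1 / norm (1 - cnj a * z) ^ 4) * indicator unit_disk z \<partial>lborel)"
      by (intro nn_integral_cmult) measurable
    also have "\<dots> \<le> ennreal c * ennreal (64 / 3 * pi / (1 - norm a)\<^sup>2)"
      by (intro mult_left_mono nn_integral_kernel_power4 a) auto
    also have "\<dots> = ennreal (c * (64 / 3 * pi / (1 - norm a)\<^sup>2))"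
      by (intro ennreal_mult[symmetric]) (auto simp: c_def)
    also have "\<dots> \<le> ennreal B"
    proof (intro ennreal_leI)
      have "(1 - (norm a)\<^sup>2)\<^sup>2 \<le> (2 * (1 - norm a))\<^sup>2"
        using one_minus_norm_sq_bounds[OF a(1)] by (intro power_mono) auto
      then have "c \<le> 2 powr (N * p - 4) * (2 * (1 - norm a))\<^sup>2"
        unfolding c_def by (intro mult_left_mono) auto
      then have "c * (64 / 3 * pi / (1 - norm a)\<^sup>2)
          \<le> 2 powr (N * p - 4) * (2 * (1 - norm a))\<^sup>2 * (64 / 3 * pi / (1 - norm a)\<^sup>2)"
        by (intro mult_right_mono) auto
      also have "\<dots> = B"
      proof -
        have *: "k * (2 * d)\<^sup>2 * (64 / 3 * pi / d\<^sup>2) = k * (256 / 3 * pi)" if "d \<noteq> 0" for k d :: real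
          using that by (simp add: field_simps power2_eq_square)
        show ?thesis unfolding B_def by (rule *) (use a in auto)
      qed
      finally show "c * (64 / 3 * pi / (1 - norm a)\<^sup>2) \<le> B" .
    qed
    finally show ?thesis .
  qed
  have int: "set_integrable lborel unit_disk (\<lambda>z. norm (?f z) powr p)"
    unfolding set_integrable_def
  proof (rule integrableI_nonneg)
    show "(\<lambda>z. indicator unit_disk z *\<^sub>R norm (?f z) powr p) \<in> borel_measurable lborel"
      using norm_powr_borel_measurable[OF H] by (intro borel_measurable_scaleR) auto
    show "(\<integral>\<^sup>+z. ennreal (indicator unit_disk z *\<^sub>R norm (?f z) powr p) \<partial>lborel) < \<infinity>"
      using bound by (rule order.strict_trans1) simp
  qed auto
  then show "?f \<in> bergman p" using H by (simp add: bergman_iff)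
  have "(LINT z:unit_disk|lborel. norm (?f z) powr p) \<le> B"
    unfolding set_lebesgue_integral_def
    by (rule integral_real_bounded[OF _ bound]) (simp add: B_def)
  then have "(LINT z:unit_disk|lborel. norm (?f z) powr p) / pi \<le> B / pi"
    by (intro divide_right_mono) auto
  also have "B / pi = 2 powr (N * p - 4) * (256 / 3)" by (simp add: B_def)
  finally show "bergman_norm p ?f \<le> (2 powr (N * p - 4) * (256 / 3)) powr (1 / p)"
    unfolding bergman_norm_def integral_disk_area[OF norm_powr_borel_measurable[OF H]]
    using p by (intro powr_mono2) (auto simp: set_lebesgue_integral_def intro!: integral_nonneg_AE divide_nonneg_pos)
qed

section \<open>Composition and the Bloch weight\<close>

lemma analytic_self_mapD:
  assumes "analytic_self_map \<phi>"
  shows "\<phi> \<in> H_disk" "z \<in> unit_disk \<Longrightarrow> \<phi> z \<in> unit_disk"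
  using assms unfolding analytic_self_map_def by blast+

lemma composition_op_H_disk:
  assumes \<phi>: "analytic_self_map \<phi>" and f: "f \<in> H_disk"
  shows "composition_op \<phi> f \<in> H_disk"
proof -
  have "(f \<circ> \<phi>) holomorphic_on unit_disk"
    using \<phi> f by (intro holomorphic_on_compose_gen[where t = unit_disk])
      (auto simp: analytic_self_map_def H_disk_def)
  then have "composition_op \<phi> f holomorphic_on unit_disk"
    by (rule holomorphic_transform) (simp add: composition_op_def)
  then show ?thesis by (simp add: H_disk_def composition_op_def)
qed

lemma deriv_composition_op:
  assumes \<phi>: "analytic_self_map \<phi>" and f: "f \<in> H_disk" and z: "z \<in> unit_disk"
  shows "deriv (composition_op \<phi> f) z = deriv f (\<phi> z) * deriv \<phi> z"
proof (rule DERIV_imp_deriv)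
  have "((\<lambda>w. f (\<phi> w)) has_field_derivative deriv f (\<phi> z) * deriv \<phi> z) (at z)"
    using analytic_self_mapD[OF \<phi>] z f by (intro DERIV_chain2[of f] H_disk_deriv) auto
  then show "(composition_op \<phi> f has_field_derivative deriv f (\<phi> z) * deriv \<phi> z) (at z)"
    by (rule has_field_derivative_transform_within_open[OF _ open_ball z])
       (simp add: composition_op_def)
qed

text \<open>
  The two factors of the Bloch weight of a composition (\<open>bloch_weight_composition_op\<close>).
\<close>
definition bergman_bloch_distortion :: "real \<Rightarrow> (complex \<Rightarrow> complex) \<Rightarrow> complex \<Rightarrow> real"
  where "bergman_bloch_distortion p \<phi> z =
    (1 - (norm z)\<^sup>2) / (1 - (norm (\<phi> z))\<^sup>2) powr (1 + 2 / p) * norm (deriv \<phi> z)"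

definition bergman_deriv_weight :: "real \<Rightarrow> (complex \<Rightarrow> complex) \<Rightarrow> complex \<Rightarrow> real"
  where "bergman_deriv_weight p f w = (1 - (norm w)\<^sup>2) powr (1 + 2 / p) * norm (deriv f w)"

lemma bergman_bloch_distortion_nonneg:
  "z \<in> unit_disk \<Longrightarrow> 0 \<le> bergman_bloch_distortion p \<phi> z"
  using one_minus_norm_sq_bounds[of z] by (simp add: bergman_bloch_distortion_def)

lemma bergman_deriv_weight_nonneg: "0 \<le> bergman_deriv_weight p f w"
  by (simp add: bergman_deriv_weight_def)

lemma bloch_weight_composition_op:
  assumes \<phi>: "analytic_self_map \<phi>" and f: "f \<in> H_disk" and z: "z \<in> unit_disk"
  shows "bloch_weight (composition_op \<phi> f) z = bloch_weight \<phi> z * norm (deriv f (\<phi> z))"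
    and "bloch_weight (composition_op \<phi> f) z
      = bergman_bloch_distortion p \<phi> z * bergman_deriv_weight p f (\<phi> z)"
proof -
  have "0 < 1 - (norm (\<phi> z))\<^sup>2"
    using analytic_self_mapD(2)[OF \<phi> z] by (rule one_minus_norm_sq_bounds)
  then show "bloch_weight (composition_op \<phi> f) z
      = bergman_bloch_distortion p \<phi> z * bergman_deriv_weight p f (\<phi> z)"
    by (simp add: bloch_weight_def deriv_composition_op[OF assms] norm_mult
        bergman_bloch_distortion_def bergman_deriv_weight_def)
qed (simp add: bloch_weight_def deriv_composition_op[OF assms] norm_mult)

lemma bloch_weight_le_bloch_norm:
  "f \<in> bloch \<Longrightarrow> z \<in> unit_disk \<Longrightarrow> bloch_weight f z \<le> bloch_norm f"
  using bloch_weight_le_SUP[of f z] by (simp add: bloch_norm_def add_increasing)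

lemma H_disk_continuous_deriv: "f \<in> H_disk \<Longrightarrow> continuous_on unit_disk (deriv f)"
  by (auto simp: H_disk_def intro: holomorphic_on_imp_continuous_on holomorphic_deriv)

lemma H_disk_deriv_bounded_on_cball:
  assumes f: "f \<in> H_disk" and "\<rho> < 1"
  obtains B where "0 < B" "\<And>w. norm w \<le> \<rho> \<Longrightarrow> norm (deriv f w) \<le> B"
proof -
  have "cball 0 \<rho> \<subseteq> unit_disk" using assms by auto
  then have "compact (deriv f ` cball 0 \<rho>)"
    by (intro compact_continuous_image continuous_on_subset[OF H_disk_continuous_deriv[OF f]]) auto
  then obtain B where "0 < B" "\<forall>y \<in> deriv f ` cball 0 \<rho>. norm y \<le> B"
    using compact_imp_bounded bounded_pos by metis
  then show ?thesis using that by auto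
qed

lemma bloch_weight_le_norm_deriv:
  "z \<in> unit_disk \<Longrightarrow> bloch_weight f z \<le> norm (deriv f z)"
  unfolding bloch_weight_def using one_minus_norm_sq_bounds[of z]
  by (intro mult_left_le_one_le) auto

text \<open>
  Decay at the circle already bounds the Bloch weight: on the remaining compact disk the derivative
  is bounded.
\<close>
lemma little_blochI:
  assumes h: "h \<in> H_disk" and lim: "(bloch_weight h \<longlongrightarrow> 0) to_unit_circle"
  shows "h \<in> little_bloch"
proof -
  obtain \<rho> where \<rho>: "\<rho> < 1" "\<And>z. \<rho> < norm z \<Longrightarrow> norm z < 1 \<Longrightarrow> \<bar>bloch_weight h z\<bar> < 1"
    using lim unfolding tendsto_0_to_unit_circle_iff by (meson zero_less_one)
  obtain B where B: "0 < B" "\<And>w. norm w \<le> \<rho> \<Longrightarrow> norm (deriv h w) \<le> B"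
    using H_disk_deriv_bounded_on_cball[OF h \<rho>(1)] by blast
  have "bloch_weight h z \<le> max 1 B" if z: "z \<in> unit_disk" for z
    using \<rho>(2)[of z] B(2)[of z] bloch_weight_le_norm_deriv[OF z, of h] z
    by (cases "norm z \<le> \<rho>") auto
  then have "bdd_above (bloch_weight h ` unit_disk)" by (rule bdd_aboveI2)
  then show ?thesis using h lim by (simp add: little_bloch_def bloch_def)
qed

section \<open>Test functions and the distortion\<close>

text \<open>
  Its image under the composition operator is \<open>\<phi>\<close> itself.
\<close>
definition disk_identity :: "complex \<Rightarrow> complex"
  where "disk_identity z = (if z \<in> unit_disk then z else 0)"

lemma disk_identity_bergman:
  assumes "0 < p"
  shows "disk_identity \<in> bergman p"
proof -
  have "(\<lambda>z. z) holomorphic_on unit_disk" by (intro holomorphic_intros)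
  then have "disk_identity holomorphic_on unit_disk"
    by (rule holomorphic_transform) (simp add: disk_identity_def)
  then have "disk_identity \<in> H_disk" by (simp add: H_disk_def disk_identity_def)
  moreover have "set_integrable lborel unit_disk (\<lambda>z::complex. norm z powr p)"
    using assms by (intro set_integrable_ball_continuous continuous_on_powr' continuous_intros) auto
  moreover have "set_integrable lborel unit_disk (\<lambda>z. norm (disk_identity z) powr p)
      \<longleftrightarrow> set_integrable lborel unit_disk (\<lambda>z. norm z powr p)"
    by (rule set_integrable_cong) (auto simp: disk_identity_def)
  ultimately show ?thesis by (simp add: bergman_iff)
qed

lemma composition_op_disk_identity:
  "analytic_self_map \<phi> \<Longrightarrow> composition_op \<phi> disk_identity = \<phi>"
  by (force simp: composition_op_def disk_identity_def analytic_self_map_def H_disk_def fun_eq_iff)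

lemma distortion_le_bloch_weight:
  assumes \<phi>: "analytic_self_map \<phi>" and z: "z \<in> unit_disk" and "0 < p" and "norm (\<phi> z) \<le> 1 / 2"
  shows "bergman_bloch_distortion p \<phi> z \<le> (4 / 3) powr (1 + 2 / p) * bloch_weight \<phi> z"
proof -
  have "(norm (\<phi> z))\<^sup>2 \<le> (1 / 2)\<^sup>2" using assms by (intro power_mono) auto
  then have ge: "3 / 4 \<le> 1 - (norm (\<phi> z))\<^sup>2" by (simp add: power2_eq_square)
  then have pos: "0 < (1 - (norm (\<phi> z))\<^sup>2) powr (1 + 2 / p)" by simp
  from ge have "(3 / 4) powr (1 + 2 / p) \<le> (1 - (norm (\<phi> z))\<^sup>2) powr (1 + 2 / p)"
    using assms(3) by (intro powr_mono2) auto
  then have "bloch_weight \<phi> z / (1 - (norm (\<phi> z))\<^sup>2) powr (1 + 2 / p)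
      \<le> bloch_weight \<phi> z / (3 / 4) powr (1 + 2 / p)"
    using bloch_weight_nonneg[OF z, of \<phi>] pos by (intro divide_left_mono mult_pos_pos) auto
  also have "\<dots> = (4 / 3) powr (1 + 2 / p) * bloch_weight \<phi> z"
    by (simp add: powr_divide)
  finally show ?thesis by (simp add: bergman_bloch_distortion_def bloch_weight_def)
qed

lemma bloch_weight_composition_op_peak_function:
  assumes \<phi>: "analytic_self_map \<phi>" and z: "z \<in> unit_disk"
  shows "bloch_weight (composition_op \<phi> (peak_function p N (\<phi> z))) z
    = N * norm (\<phi> z) * bergman_bloch_distortion p \<phi> z"
proof -
  have \<phi>z: "\<phi> z \<in> unit_disk" using analytic_self_mapD(2)[OF \<phi> z] .
  have "0 < 1 - (norm (\<phi> z))\<^sup>2" using \<phi>z by (rule one_minus_norm_sq_bounds)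
  then have "(1 - (norm (\<phi> z))\<^sup>2) powr (1 + 2 / p) * (1 - (norm (\<phi> z))\<^sup>2) powr (- (1 + 2 / p)) = 1"
    by (simp only: powr_add[symmetric]) simp
  moreover have "bergman_deriv_weight p (peak_function p N (\<phi> z)) (\<phi> z) = N * norm (\<phi> z)
      * ((1 - (norm (\<phi> z))\<^sup>2) powr (1 + 2 / p) * (1 - (norm (\<phi> z))\<^sup>2) powr (- (1 + 2 / p)))"
    by (simp only: bergman_deriv_weight_def norm_deriv_peak_function_self[OF \<phi>z] mult_ac)
  ultimately have "bergman_deriv_weight p (peak_function p N (\<phi> z)) (\<phi> z) = N * norm (\<phi> z)"
    by (simp only: mult_1_right)
  then show ?thesis
    by (simp add: bloch_weight_composition_op(2)[where p = p, OF \<phi> peak_function_H_disk[OF \<phi>z] z])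
qed

text \<open>
  One bounded family that tests all points at once: every \<open>z\<close> with \<open>|\<phi>(z)| \<ge> 1/2\<close> is served by the
  member with peak \<open>\<phi>(z)\<close>.
\<close>
definition peak_family :: "real \<Rightarrow> (complex \<Rightarrow> complex) set"
  where "peak_family p = peak_function p (nat \<lceil>4 / p\<rceil>) ` {a \<in> unit_disk. 1 / 2 \<le> norm a}"

lemma peak_family_bergman:
  assumes p: "0 < p"
  shows "peak_family p \<subseteq> bergman p" "norm_bounded (bergman_norm p) (peak_family p)"
proof -
  have "4 / p \<le> real (nat \<lceil>4 / p\<rceil>)" by (rule real_nat_ceiling_ge)
  then have "4 / p * p \<le> real (nat \<lceil>4 / p\<rceil>) * p" using p by (intro mult_right_mono) auto
  then have N: "4 \<le> real (nat \<lceil>4 / p\<rceil>) * p" using p by simp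
  show "peak_family p \<subseteq> bergman p"
    using peak_function_bergman(1)[OF p N] by (auto simp: peak_family_def)
  show "norm_bounded (bergman_norm p) (peak_family p)"
    using peak_function_bergman(2)[OF p N] unfolding norm_bounded_def peak_family_def by blast
qed

text \<open>
  Uniform control of the Bloch weights of the images of the family, and of \<open>\<phi>\<close>, at \<open>z\<close> controls the
  distortion at \<open>z\<close>. With a fixed bound this gives bounded distortion, with a bound tending to 0
  vanishing distortion.
\<close>
lemma distortion_le_peak_family:
  assumes \<phi>: "analytic_self_map \<phi>" and p: "0 < p" and z: "z \<in> unit_disk"
    and b: "\<And>f. f \<in> peak_family p \<Longrightarrow> bloch_weight (composition_op \<phi> f) z \<le> b"
    and b': "bloch_weight \<phi> z \<le> b"
  shows "bergman_bloch_distortion p \<phi> z \<le> (2 + (4 / 3) powr (1 + 2 / p)) * b"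
proof -
  have b0: "0 \<le> b" using b' bloch_weight_nonneg[OF z, of \<phi>] by linarith
  show ?thesis
  proof (cases "norm (\<phi> z) \<le> 1 / 2")
    case True
    have "bergman_bloch_distortion p \<phi> z \<le> (4 / 3) powr (1 + 2 / p) * bloch_weight \<phi> z"
      by (rule distortion_le_bloch_weight[OF \<phi> z p True])
    also have "\<dots> \<le> (4 / 3) powr (1 + 2 / p) * b" by (intro mult_left_mono b') auto
    finally show ?thesis using b0 by (simp add: distrib_right)
  next
    case False
    let ?N = "nat \<lceil>4 / p\<rceil>"
    have "0 < \<lceil>4 / p\<rceil>" using p by simp
    then have N: "1 \<le> real ?N" by linarith
    have "peak_function p ?N (\<phi> z) \<in> peak_family p"
      using False analytic_self_mapD(2)[OF \<phi> z] by (auto simp: peak_family_def)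
    then have *: "?N * norm (\<phi> z) * bergman_bloch_distortion p \<phi> z \<le> b"
      using b bloch_weight_composition_op_peak_function[OF \<phi> z] by metis
    have "1 * (1 / 2) \<le> ?N * norm (\<phi> z)" using False N by (intro mult_mono) auto
    then have "1 / 2 * bergman_bloch_distortion p \<phi> z \<le> ?N * norm (\<phi> z) * bergman_bloch_distortion p \<phi> z"
      using bergman_bloch_distortion_nonneg[OF z] by (intro mult_right_mono) auto
    then have "bergman_bloch_distortion p \<phi> z \<le> 2 * b" using * by linarith
    also have "\<dots> \<le> (2 + (4 / 3) powr (1 + 2 / p)) * b" using b0 by (intro mult_right_mono) auto
    finally show ?thesis .
  qed
qed

section \<open>Images in the little Bloch space\<close>

text \<open>
  Cut at \<open>|\<phi>(z)| = \<rho>\<close>, where beyond \<open>\<rho>\<close> the weighted derivative of \<open>f\<close> is small. Inside, \<open>f'\<close> is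
  bounded by some \<open>B\<close> and the weight of \<open>f \<circ> \<phi>\<close> is at most \<open>B\<close> times the weight of \<open>\<phi>\<close>.
\<close>
lemma composition_op_little_bloch_of_bounded_distortion:
  assumes \<phi>: "analytic_self_map \<phi>" and "\<phi> \<in> little_bloch"
    and M: "\<And>z. z \<in> unit_disk \<Longrightarrow> bergman_bloch_distortion p \<phi> z \<le> M"
    and f: "f \<in> H_disk" and lim: "(bergman_deriv_weight p f \<longlongrightarrow> 0) to_unit_circle"
  shows "composition_op \<phi> f \<in> little_bloch"
proof (rule little_blochI[OF composition_op_H_disk[OF \<phi> f]], unfold tendsto_0_to_unit_circle_iff, intro allI impI)
  fix \<epsilon> :: real assume \<epsilon>: "0 < \<epsilon>"
  have M0: "0 \<le> M" using M[of 0] bergman_bloch_distortion_nonneg[of 0 p \<phi>] by simp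
  \<comment> \<open>\<open>M + 1\<close> instead of \<open>M\<close>, which may be 0\<close>
  have "0 < \<epsilon> / (M + 1)" using \<epsilon> M0 by simp
  then obtain \<rho> where \<rho>: "\<rho> < 1"
      "\<And>w. \<rho> < norm w \<Longrightarrow> norm w < 1 \<Longrightarrow> \<bar>bergman_deriv_weight p f w\<bar> < \<epsilon> / (M + 1)"
    using lim unfolding tendsto_0_to_unit_circle_iff by meson
  obtain B where B: "0 < B" "\<And>w. norm w \<le> \<rho> \<Longrightarrow> norm (deriv f w) \<le> B"
    using H_disk_deriv_bounded_on_cball[OF f \<rho>(1)] by blast
  have "(bloch_weight \<phi> \<longlongrightarrow> 0) to_unit_circle" using assms(2) by (simp add: little_bloch_def)
  moreover have "0 < \<epsilon> / B" using \<epsilon> B by simp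
  ultimately obtain \<rho>' where \<rho>': "\<rho>' < 1"
      "\<And>z. \<rho>' < norm z \<Longrightarrow> norm z < 1 \<Longrightarrow> \<bar>bloch_weight \<phi> z\<bar> < \<epsilon> / B"
    unfolding tendsto_0_to_unit_circle_iff by meson
  show "\<exists>\<rho><1. \<forall>z. \<rho> < norm z \<and> norm z < 1 \<longrightarrow> \<bar>bloch_weight (composition_op \<phi> f) z\<bar> < \<epsilon>"
  proof (intro exI[of _ \<rho>'] conjI allI impI)
    fix z :: complex assume z: "\<rho>' < norm z \<and> norm z < 1"
    then have zd: "z \<in> unit_disk" by simp
    have "bloch_weight (composition_op \<phi> f) z < \<epsilon>"
    proof (cases "norm (\<phi> z) \<le> \<rho>")
      case True
      have "bloch_weight (composition_op \<phi> f) z \<le> bloch_weight \<phi> z * B"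
        unfolding bloch_weight_composition_op(1)[OF \<phi> f zd]
        using B(2)[OF True] bloch_weight_nonneg[OF zd] by (intro mult_left_mono) auto
      also have "\<dots> < \<epsilon>" using \<rho>'(2)[of z] z B(1) bloch_weight_nonneg[OF zd, of \<phi>] by (simp add: field_simps)
      finally show ?thesis .
    next
      case False
      then have w: "bergman_deriv_weight p f (\<phi> z) < \<epsilon> / (M + 1)"
        using \<rho>(2)[of "\<phi> z"] analytic_self_mapD(2)[OF \<phi> zd] by auto
      have "bloch_weight (composition_op \<phi> f) z \<le> M * (\<epsilon> / (M + 1))"
        unfolding bloch_weight_composition_op(2)[OF \<phi> f zd, of p]
        using M[OF zd] w M0 bergman_deriv_weight_nonneg by (intro mult_mono) auto
      also have "\<dots> < \<epsilon>" using \<epsilon> M0 by (simp add: field_simps)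
      finally show ?thesis .
    qed
    then show "\<bar>bloch_weight (composition_op \<phi> f) z\<bar> < \<epsilon>"
      using bloch_weight_nonneg[OF zd] by simp
  qed (rule \<rho>')
qed

text \<open>
  The weight of the composition is at most \<open>A\<close> times the distortion. Stated for a derivative bound,
  the lemma applies to locally uniform limits of Bergman functions as well.
\<close>
lemma composition_op_little_bloch_of_vanishing_distortion:
  assumes \<phi>: "analytic_self_map \<phi>"
    and lim: "(bergman_bloch_distortion p \<phi> \<longlongrightarrow> 0) to_unit_circle"
    and f: "f \<in> H_disk" and A: "\<And>w. w \<in> unit_disk \<Longrightarrow> bergman_deriv_weight p f w \<le> A"
  shows "composition_op \<phi> f \<in> little_bloch"
proof (rule little_blochI[OF composition_op_H_disk[OF \<phi> f]])
  have "((\<lambda>z. bergman_bloch_distortion p \<phi> z * A) \<longlongrightarrow> 0) to_unit_circle"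
    using lim by (rule tendsto_mult_left_zero)
  then show "(bloch_weight (composition_op \<phi> f) \<longlongrightarrow> 0) to_unit_circle"
  proof (rule tendsto_sandwich[OF _ _ tendsto_const, rotated 2])
    have disk: "\<forall>\<^sub>F z in to_unit_circle. z \<in> unit_disk"
      using eventually_to_unit_circle_norm_gt[of 0] by (auto elim: eventually_mono)
    then show "\<forall>\<^sub>F z in to_unit_circle. 0 \<le> bloch_weight (composition_op \<phi> f) z"
      by eventually_elim (rule bloch_weight_nonneg)
    show "\<forall>\<^sub>F z in to_unit_circle.
        bloch_weight (composition_op \<phi> f) z \<le> bergman_bloch_distortion p \<phi> z * A"
      using disk
    proof eventually_elim
      case (elim z)
      show ?case
        unfolding bloch_weight_composition_op(2)[OF \<phi> f elim, of p]
        using A analytic_self_mapD(2)[OF \<phi> elim] bergman_bloch_distortion_nonneg[OF elim]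
        by (intro mult_left_mono) auto
    qed
  qed
qed

section \<open>Compactness in the little Bloch space\<close>

text \<open>
  The finitely many members of an \<open>\<epsilon>/2\<close>-net decay simultaneously, and the Bloch norm dominates the
  weight of a difference at every point.
\<close>
lemma totally_bounded_little_bloch_uniform_decay:
  assumes S: "little_bloch.mtotally_bounded S" and \<epsilon>: "0 < \<epsilon>"
  shows "\<forall>\<^sub>F z in to_unit_circle. z \<in> unit_disk \<and> (\<forall>h\<in>S. bloch_weight h z \<le> \<epsilon>)"
proof -
  have "\<exists>K. finite K \<and> K \<subseteq> S \<and> S \<subseteq> (\<Union>g\<in>K. little_bloch.mball g (\<epsilon> / 2))"
    using S \<epsilon> unfolding little_bloch.mtotally_bounded_def by (meson half_gt_zero)
  then obtain K where K: "finite K" "K \<subseteq> S" "S \<subseteq> (\<Union>g\<in>K. little_bloch.mball g (\<epsilon> / 2))" by blast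
  have SY: "S \<subseteq> little_bloch" using S by (rule little_bloch.mtotally_bounded_imp_subset)
  have "\<forall>\<^sub>F z in to_unit_circle. \<forall>g\<in>K. bloch_weight g z < \<epsilon> / 2"
  proof (rule eventually_ball_finite[OF K(1)], intro ballI)
    fix g assume "g \<in> K"
    then have "(bloch_weight g \<longlongrightarrow> 0) to_unit_circle" using K SY by (auto simp: little_bloch_def)
    then show "\<forall>\<^sub>F z in to_unit_circle. bloch_weight g z < \<epsilon> / 2"
      using \<epsilon> by (intro order_tendstoD) auto
  qed
  moreover have "\<forall>\<^sub>F z in to_unit_circle. z \<in> unit_disk"
    using eventually_to_unit_circle_norm_gt[of 0] by (auto elim: eventually_mono)
  ultimately show ?thesis
  proof eventually_elim
    case (elim z)
    have "bloch_weight h z \<le> \<epsilon>" if h: "h \<in> S" for h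
    proof -
      obtain g where g: "g \<in> K" "h \<in> little_bloch.mball g (\<epsilon> / 2)" using K h by blast
      then have gh: "g \<in> little_bloch" "h \<in> little_bloch" "bloch_norm (\<lambda>w. g w - h w) < \<epsilon> / 2"
        by (auto simp: little_bloch.in_mball norm_dist_def)
      then have B: "g \<in> bloch" "h \<in> bloch" by (auto simp: little_bloch_def)
      have "bloch_weight (\<lambda>w. g w - h w) z < \<epsilon> / 2"
        using bloch_weight_le_bloch_norm[OF bloch_diff[OF B] elim(2)] gh(3) by simp
      moreover have "bloch_weight h z \<le> bloch_weight g z + bloch_weight (\<lambda>w. g w - h w) z"
        using bloch_weight_diff_le[of g "\<lambda>w. g w - h w" z] B H_disk_diff[of g h] elim(2)
        by (simp add: bloch_def)
      ultimately show ?thesis using elim(1) g(1) by fastforce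
    qed
    then show ?case using elim(2) by blast
  qed
qed

text \<open>
  Cauchy's inequality for \<open>f n - g\<close> on circles of radius \<open>(1 - \<rho>)/2\<close>, all of which lie in one
  compact disk.
\<close>
lemma uniform_limit_deriv_cball:
  assumes f: "\<And>n. f n \<in> H_disk" and g: "g \<in> H_disk"
    and lim: "\<And>K. compact K \<Longrightarrow> K \<subseteq> unit_disk \<Longrightarrow> uniform_limit K f g sequentially"
    and \<rho>: "\<rho> < 1"
  shows "uniform_limit (cball 0 \<rho>) (\<lambda>n. deriv (f n)) (deriv g) sequentially"
proof (rule uniform_limitI)
  fix e :: real assume e: "0 < e"
  define s where "s = (1 - \<rho>) / 2"
  have s: "0 < s" "\<rho> + s < 1" using \<rho> by (auto simp: s_def field_simps)
  have "uniform_limit (cball 0 (\<rho> + s)) f g sequentially" using s by (intro lim) auto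
  then have "\<forall>\<^sub>F n in sequentially. \<forall>w\<in>cball 0 (\<rho> + s). dist (f n w) (g w) < e / 2 * s"
    by (rule uniform_limitD) (use e s in auto)
  then show "\<forall>\<^sub>F n in sequentially. \<forall>w\<in>cball 0 \<rho>. dist (deriv (f n) w) (deriv g w) < e"
  proof eventually_elim
    case (elim n)
    show ?case
    proof
      fix w :: complex assume w: "w \<in> cball 0 \<rho>"
      have sub: "cball w s \<subseteq> cball 0 (\<rho> + s)"
      proof
        fix y assume "y \<in> cball w s"
        then show "y \<in> cball 0 (\<rho> + s)" using w dist_triangle[of 0 y w] by (simp add: dist_norm)
      qed
      have wd: "w \<in> unit_disk" using w \<rho> by auto
      have subd: "cball w s \<subseteq> unit_disk" using sub s by auto
      have hol: "(\<lambda>w. f n w - g w) holomorphic_on unit_disk"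
        using H_disk_diff[OF f g, of n] by (simp add: H_disk_def)
      have "norm ((deriv ^^ 1) (\<lambda>w. f n w - g w) w) \<le> fact 1 * (e / 2 * s) / s ^ 1"
      proof (rule Cauchy_inequality)
        show "(\<lambda>w. f n w - g w) holomorphic_on ball w s"
          using subd by (intro holomorphic_on_subset[OF hol]) auto
        show "continuous_on (cball w s) (\<lambda>w. f n w - g w)"
          using subd by (intro holomorphic_on_imp_continuous_on holomorphic_on_subset[OF hol])
        fix x assume "norm (w - x) = s"
        then have "x \<in> cball 0 (\<rho> + s)" using sub by (simp add: dist_norm subset_iff)
        then have "dist (f n x) (g x) < e / 2 * s" using elim by blast
        then show "norm (f n x - g x) \<le> e / 2 * s" by (simp add: dist_norm)
      qed (use s in auto)
      then have "norm (deriv (f n) w - deriv g w) \<le> e / 2"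
        using s by (simp add: deriv_diff_H_disk[OF f g wd])
      then show "dist (deriv (f n) w) (deriv g w) < e" using e by (simp add: dist_norm)
    qed
  qed
qed

text \<open>
  The growth bound makes the family locally bounded, so Montel's theorem applies. The bound on the
  weighted derivatives passes to the limit pointwise.
\<close>
lemma bergman_bounded_Montel:
  assumes p: "0 < p" and f: "\<And>n. f n \<in> bergman p" and bnd: "\<And>n. bergman_norm p (f n) \<le> A"
  obtains g r A' where "g \<in> H_disk" "strict_mono (r :: nat \<Rightarrow> nat)"
    "\<And>w. w \<in> unit_disk \<Longrightarrow> (\<lambda>n. f (r n) w) \<longlonglongrightarrow> g w"
    "\<And>\<rho>. \<rho> < 1 \<Longrightarrow> uniform_limit (cball 0 \<rho>) (\<lambda>n. deriv (f (r n))) (deriv g) sequentially"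
    "\<And>n w. w \<in> unit_disk \<Longrightarrow> bergman_deriv_weight p (f n) w \<le> A'"
    "\<And>w. w \<in> unit_disk \<Longrightarrow> bergman_deriv_weight p g w \<le> A'"
proof -
  have H: "f n \<in> H_disk" for n using f by (rule bergman_imp_H_disk)
  obtain K where K: "0 < K" "\<And>f w. f \<in> bergman p \<Longrightarrow> w \<in> unit_disk
           \<Longrightarrow> (1 - norm w) powr (2 / p) * norm (f w) \<le> K * bergman_norm p f"
    using bergman_growth[OF p] by blast
  obtain K' where K': "0 < K'" "\<And>f w. f \<in> bergman p \<Longrightarrow> w \<in> unit_disk
           \<Longrightarrow> (1 - (norm w)\<^sup>2) powr (1 + 2 / p) * norm (deriv f w) \<le> K' * bergman_norm p f"
    using bergman_deriv_bound[OF p] by blast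
  have A': "bergman_deriv_weight p (f n) w \<le> K' * A" if "w \<in> unit_disk" for n w
    unfolding bergman_deriv_weight_def
    by (rule order.trans[OF K'(2)[OF f that] mult_left_mono[OF bnd]]) (use K' in simp)
  have loc: "\<exists>B. \<forall>h\<in>range f. \<forall>z\<in>X. norm (h z) \<le> B" if X: "compact X" "X \<subseteq> unit_disk" for X
  proof (cases "X = {}")
    case False
    have "continuous_on X (norm :: complex \<Rightarrow> real)" by (intro continuous_intros)
    then obtain w where w: "w \<in> X" "\<And>v. v \<in> X \<Longrightarrow> norm v \<le> norm w"
      using continuous_attains_sup[OF X(1) False] by blast
    have w1: "norm w < 1" using w X by auto
    have "norm (f n v) \<le> K * A / (1 - norm w) powr (2 / p)" if v: "v \<in> X" for n v
    proof -
      have "(1 - norm w) powr (2 / p) * norm (f n v) \<le> (1 - norm v) powr (2 / p) * norm (f n v)"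
        using w(2)[OF v] w1 p by (intro mult_right_mono powr_mono2) auto
      also have "\<dots> \<le> K * bergman_norm p (f n)" using v X by (intro K(2) f) auto
      also have "\<dots> \<le> K * A" using K(1) bnd by (intro mult_left_mono) auto
      finally show ?thesis using w1 by (simp add: field_simps)
    qed
    then show ?thesis by blast
  qed simp
  obtain g0 r where g0: "g0 holomorphic_on unit_disk" "strict_mono (r :: nat \<Rightarrow> nat)"
      "\<And>x. x \<in> unit_disk \<Longrightarrow> (\<lambda>n. f (r n) x) \<longlonglongrightarrow> g0 x"
      "\<And>X. compact X \<Longrightarrow> X \<subseteq> unit_disk \<Longrightarrow> uniform_limit X (f \<circ> r) g0 sequentially"
  proof (rule Montel[of unit_disk "range f" f])
    show "h holomorphic_on unit_disk" if "h \<in> range f" for h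
      using that H by (auto simp: H_disk_def)
  qed (use loc in auto)
  \<comment> \<open>elements of \<open>H_disk\<close> vanish off the disk, where the limit is arbitrary\<close>
  define g where "g z = (if z \<in> unit_disk then g0 z else 0)" for z
  have gH: "g \<in> H_disk"
    using holomorphic_transform[OF g0(1), of g] by (simp add: H_disk_def g_def)
  have "uniform_limit X (\<lambda>n. f (r n)) g sequentially" if X: "compact X" "X \<subseteq> unit_disk" for X
  proof -
    have "g x = g0 x" if "x \<in> X" for x using X(2) that by (auto simp: g_def)
    then show ?thesis using g0(4)[OF X] by (simp add: uniform_limit_iff)
  qed
  then have lim': "uniform_limit (cball 0 \<rho>) (\<lambda>n. deriv (f (r n))) (deriv g) sequentially" if "\<rho> < 1" for \<rho>
    using that by (intro uniform_limit_deriv_cball H gH) auto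
  show ?thesis
  proof (rule that[OF gH g0(2) _ lim' A'])
    show "(\<lambda>n. f (r n) w) \<longlonglongrightarrow> g w" if "w \<in> unit_disk" for w
      using g0(3)[OF that] that by (simp add: g_def)
    fix w :: complex assume w: "w \<in> unit_disk"
    then have "(\<lambda>n. deriv (f (r n)) w) \<longlonglongrightarrow> deriv g w"
      by (intro tendsto_uniform_limitI[OF lim'[of "norm w"]]) auto
    then have "(\<lambda>n. bergman_deriv_weight p (f (r n)) w) \<longlonglongrightarrow> bergman_deriv_weight p g w"
      unfolding bergman_deriv_weight_def by (intro tendsto_intros)
    then show "bergman_deriv_weight p g w \<le> K' * A"
      by (rule LIMSEQ_le_const2) (use A'[OF w] in auto)
  qed
qed

text \<open>
  Choose \<open>\<rho>\<close> such that the distortion is small beyond \<open>|z| = \<rho>\<close>; there the weighted derivatives of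
  \<open>f (r n)\<close> and \<open>g\<close> are at most \<open>A'\<close> each. On \<open>|z| \<le> \<rho>\<close> the values of \<open>\<phi>\<close> stay in a compact disk, where
  \<open>f (r n)\<close> converges to \<open>g\<close> together with its derivative.
\<close>
lemma composition_op_subsequence_converges:
  assumes \<phi>: "analytic_self_map \<phi>" and p: "0 < p"
    and van: "(bergman_bloch_distortion p \<phi> \<longlongrightarrow> 0) to_unit_circle"
    and f: "\<And>n. f n \<in> bergman p" and bnd: "\<And>n. bergman_norm p (f n) \<le> A"
  obtains h r where "strict_mono (r :: nat \<Rightarrow> nat)"
    "limitin little_bloch.mtopology (\<lambda>n. composition_op \<phi> (f (r n))) h sequentially"
proof -
  obtain g r A' where g: "g \<in> H_disk" and r: "strict_mono (r :: nat \<Rightarrow> nat)"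
    and ptw: "\<And>w. w \<in> unit_disk \<Longrightarrow> (\<lambda>n. f (r n) w) \<longlonglongrightarrow> g w"
    and unif: "\<And>\<rho>. \<rho> < 1 \<Longrightarrow> uniform_limit (cball 0 \<rho>) (\<lambda>n. deriv (f (r n))) (deriv g) sequentially"
    and Af: "\<And>n w. w \<in> unit_disk \<Longrightarrow> bergman_deriv_weight p (f n) w \<le> A'"
    and Ag: "\<And>w. w \<in> unit_disk \<Longrightarrow> bergman_deriv_weight p g w \<le> A'"
    by (rule bergman_bounded_Montel[OF p f bnd]) (rule that)
  have H: "f n \<in> H_disk" for n using f by (rule bergman_imp_H_disk)
  let ?F = "\<lambda>n. composition_op \<phi> (f (r n))" and ?h = "composition_op \<phi> g"
  have F: "?F n \<in> little_bloch" for n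
    by (rule composition_op_little_bloch_of_vanishing_distortion[OF \<phi> van H Af])
  have h: "?h \<in> little_bloch"
    by (rule composition_op_little_bloch_of_vanishing_distortion[OF \<phi> van g Ag])
  have A'0: "0 \<le> A'" using Ag[of 0] bergman_deriv_weight_nonneg[of p g 0] by simp
  have diff: "(\<lambda>z. ?F n z - ?h z) = composition_op \<phi> (\<lambda>z. f (r n) z - g z)" for n
    by (auto simp: composition_op_def)
  have "\<forall>\<^sub>F n in sequentially. ?F n \<in> little_bloch \<and> norm_dist bloch_norm little_bloch (?F n) ?h < \<epsilon>"
    if \<epsilon>: "0 < \<epsilon>" for \<epsilon>
  proof -
    \<comment> \<open>the summand 1 keeps the denominator positive if \<open>A' = 0\<close>\<close>
    define \<epsilon>1 where "\<epsilon>1 = \<epsilon> / 3 / (2 * A' + 1)"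
    have "0 < \<epsilon>1" using \<epsilon> A'0 by (simp add: \<epsilon>1_def)
    then obtain \<rho> where \<rho>: "\<rho> < 1"
        "\<And>z. \<rho> < norm z \<Longrightarrow> norm z < 1 \<Longrightarrow> \<bar>bergman_bloch_distortion p \<phi> z\<bar> < \<epsilon>1"
      using van unfolding tendsto_0_to_unit_circle_iff by meson
    obtain B where B: "0 < B" "\<And>w. norm w \<le> \<rho> \<Longrightarrow> norm (deriv \<phi> w) \<le> B"
      using H_disk_deriv_bounded_on_cball[OF analytic_self_mapD(1)[OF \<phi>] \<rho>(1)] by blast
    have "\<exists>\<rho>'<1. \<forall>z\<in>cball 0 \<rho>. norm (\<phi> z) \<le> \<rho>'"
    proof (cases "cball (0::complex) \<rho> = {}")
      case False
      have sub: "cball 0 \<rho> \<subseteq> unit_disk" using \<rho> by auto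
      have "continuous_on unit_disk \<phi>"
        using analytic_self_mapD(1)[OF \<phi>] by (simp add: H_disk_def holomorphic_on_imp_continuous_on)
      then have "continuous_on (cball 0 \<rho>) (\<lambda>z. norm (\<phi> z))"
        using sub by (intro continuous_on_norm) (rule continuous_on_subset)
      then obtain w where "w \<in> cball 0 \<rho>" "\<And>z. z \<in> cball 0 \<rho> \<Longrightarrow> norm (\<phi> z) \<le> norm (\<phi> w)"
        using continuous_attains_sup[OF compact_cball False] by metis
      moreover have "norm (\<phi> w) < 1"
        using analytic_self_mapD(2)[OF \<phi>, of w] sub calculation(1) by auto
      ultimately show ?thesis by blast
    next
      case True
      show ?thesis unfolding True by (intro exI[of _ 0]) simp
    qed
    then obtain \<rho>' where \<rho>': "\<rho>' < 1" "\<And>z. z \<in> cball 0 \<rho> \<Longrightarrow> norm (\<phi> z) \<le> \<rho>'" by blast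
    have "\<forall>\<^sub>F n in sequentially. \<forall>w\<in>cball 0 \<rho>'. dist (deriv (f (r n)) w) (deriv g w) < \<epsilon> / 3 / B"
      using unif[OF \<rho>'(1)] by (rule uniform_limitD) (use \<epsilon> B in auto)
    moreover have "\<forall>\<^sub>F n in sequentially. dist (f (r n) (\<phi> 0)) (g (\<phi> 0)) < \<epsilon> / 3"
      using \<epsilon> by (intro tendstoD ptw analytic_self_mapD(2)[OF \<phi>]) auto
    ultimately show ?thesis
    proof eventually_elim
      case (elim n)
      have D: "(\<lambda>z. f (r n) z - g z) \<in> H_disk" by (rule H_disk_diff[OF H g])
      have "bloch_weight (\<lambda>z. ?F n z - ?h z) z \<le> \<epsilon> / 3" if z: "z \<in> unit_disk" for z
      proof (cases "norm z \<le> \<rho>")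
        case True
        have "\<phi> z \<in> cball 0 \<rho>'" using \<rho>'(2)[of z] True by simp
        then have "norm (deriv (f (r n)) (\<phi> z) - deriv g (\<phi> z)) \<le> \<epsilon> / 3 / B"
          using elim(1) by (auto simp: dist_norm intro: less_imp_le)
        moreover have "bloch_weight \<phi> z \<le> B"
          using B(2)[OF True] bloch_weight_le_norm_deriv[OF z, of \<phi>] by simp
        ultimately have "bloch_weight \<phi> z * norm (deriv (f (r n)) (\<phi> z) - deriv g (\<phi> z)) \<le> B * (\<epsilon> / 3 / B)"
          using B(1) by (intro mult_mono) auto
        then show ?thesis
          unfolding diff bloch_weight_composition_op(1)[OF \<phi> D z]
          using B(1) by (simp add: deriv_diff_H_disk[OF H g analytic_self_mapD(2)[OF \<phi> z]])
      next
        case False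
        have \<phi>z: "\<phi> z \<in> unit_disk" by (rule analytic_self_mapD(2)[OF \<phi> z])
        have "bergman_deriv_weight p (\<lambda>z. f (r n) z - g z) (\<phi> z)
            \<le> bergman_deriv_weight p (f (r n)) (\<phi> z) + bergman_deriv_weight p g (\<phi> z)"
          unfolding bergman_deriv_weight_def deriv_diff_H_disk[OF H g \<phi>z] distrib_left[symmetric]
          by (intro mult_left_mono norm_triangle_ineq4) auto
        also have "\<dots> \<le> 2 * A'" using Af[OF \<phi>z, of "r n"] Ag[OF \<phi>z] by simp
        finally have w: "bergman_deriv_weight p (\<lambda>z. f (r n) z - g z) (\<phi> z) \<le> 2 * A'" .
        have "bloch_weight (\<lambda>z. ?F n z - ?h z) z \<le> \<epsilon>1 * (2 * A')"
          unfolding diff bloch_weight_composition_op(2)[OF \<phi> D z, of p]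
          using w \<rho>(2)[of z] False z \<open>0 < \<epsilon>1\<close> bergman_deriv_weight_nonneg by (intro mult_mono) auto
        also have "\<dots> \<le> \<epsilon>1 * (2 * A' + 1)" using \<open>0 < \<epsilon>1\<close> by (intro mult_left_mono) auto
        also have "\<dots> = \<epsilon> / 3"
        proof -
          have cancel: "x / y * y = x" if "y \<noteq> 0" for x y :: real using that by simp
          show ?thesis unfolding \<epsilon>1_def by (rule cancel) (use A'0 in linarith)
        qed
        finally show ?thesis .
      qed
      then have "(SUP z\<in>unit_disk. bloch_weight (\<lambda>z. ?F n z - ?h z) z) \<le> \<epsilon> / 3"
        by (intro cSUP_least) auto
      moreover have "norm (?F n 0 - ?h 0) < \<epsilon> / 3"
        using elim(2) by (simp add: composition_op_def dist_norm)
      ultimately show ?case using F[of n] h \<epsilon> by (simp add: norm_dist_def bloch_norm_def)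
    qed
  qed
  then have "limitin little_bloch.mtopology ?F ?h sequentially"
    using h by (simp add: little_bloch.limitin_metric)
  then show ?thesis using that r by blast
qed

section \<open>Bounded and compact composition operators\<close>

lemma bounded_into_bloch_imp_bounded_distortion:
  assumes \<phi>: "analytic_self_map \<phi>" and p: "0 < p" and "\<phi> \<in> bloch"
    and bop: "bounded_op (bergman_norm p) (bergman p) bloch_norm bloch (composition_op \<phi>)"
  obtains M where "\<And>z. z \<in> unit_disk \<Longrightarrow> bergman_bloch_distortion p \<phi> z \<le> M"
proof -
  have "norm_bounded bloch_norm (composition_op \<phi> ` peak_family p)"
    using bop peak_family_bergman[OF p] by (simp add: bounded_op_def)
  then obtain C where C: "\<And>f. f \<in> peak_family p \<Longrightarrow> bloch_norm (composition_op \<phi> f) \<le> C"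
    by (auto simp: norm_bounded_def)
  have bl: "composition_op \<phi> f \<in> bloch" if "f \<in> peak_family p" for f
    using bop peak_family_bergman(1)[OF p] that by (auto simp: bounded_op_def)
  show ?thesis
  proof
    fix z assume z: "z \<in> unit_disk"
    show "bergman_bloch_distortion p \<phi> z \<le> (2 + (4 / 3) powr (1 + 2 / p)) * max C (bloch_norm \<phi>)"
    proof (rule distortion_le_peak_family[OF \<phi> p z])
      show "bloch_weight (composition_op \<phi> f) z \<le> max C (bloch_norm \<phi>)" if "f \<in> peak_family p" for f
        using bloch_weight_le_bloch_norm[OF bl[OF that] z] C[OF that] by simp
      show "bloch_weight \<phi> z \<le> max C (bloch_norm \<phi>)"
        using bloch_weight_le_bloch_norm[OF assms(3) z] by simp
    qed
  qed
qed

lemma bounded_op_little_bloch_iff: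
  assumes \<phi>: "analytic_self_map \<phi>" and p: "0 < p"
  shows "bounded_op (bergman_norm p) (bergman p) bloch_norm little_bloch (composition_op \<phi>)
    \<longleftrightarrow> bounded_op (bergman_norm p) (bergman p) bloch_norm bloch (composition_op \<phi>) \<and> \<phi> \<in> little_bloch"
proof
  assume L: "bounded_op (bergman_norm p) (bergman p) bloch_norm little_bloch (composition_op \<phi>)"
  then have "composition_op \<phi> disk_identity \<in> little_bloch"
    using disk_identity_bergman[OF p] by (auto simp: bounded_op_def)
  then show "bounded_op (bergman_norm p) (bergman p) bloch_norm bloch (composition_op \<phi>) \<and> \<phi> \<in> little_bloch"
    using L by (auto simp: bounded_op_def composition_op_disk_identity[OF \<phi>] little_bloch_def)
next
  assume R: "bounded_op (bergman_norm p) (bergman p) bloch_norm bloch (composition_op \<phi>) \<and> \<phi> \<in> little_bloch"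
  then have "\<phi> \<in> bloch" by (simp add: little_bloch_def)
  then obtain M where M: "\<And>z. z \<in> unit_disk \<Longrightarrow> bergman_bloch_distortion p \<phi> z \<le> M"
    using bounded_into_bloch_imp_bounded_distortion[OF \<phi> p _ conjunct1[OF R]] by blast
  have "composition_op \<phi> f \<in> little_bloch" if f: "f \<in> bergman p" for f
  proof (rule composition_op_little_bloch_of_bounded_distortion[OF \<phi> conjunct2[OF R] M])
    show "f \<in> H_disk" using f by (rule bergman_imp_H_disk)
    show "(bergman_deriv_weight p f \<longlongrightarrow> 0) to_unit_circle"
      unfolding bergman_deriv_weight_def[abs_def] by (rule bergman_deriv_tendsto_0[OF p f])
  qed
  then show "bounded_op (bergman_norm p) (bergman p) bloch_norm little_bloch (composition_op \<phi>)"
    using R by (auto simp: bounded_op_def)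
qed

lemma compact_op_imp_vanishing_distortion:
  assumes \<phi>: "analytic_self_map \<phi>" and p: "0 < p"
    and comp: "compact_op (bergman_norm p) (bergman p) bloch_norm little_bloch (composition_op \<phi>)"
  shows "(bergman_bloch_distortion p \<phi> \<longlongrightarrow> 0) to_unit_circle"
proof -
  let ?S = "composition_op \<phi> ` peak_family p"
  have "?S \<subseteq> little_bloch"
    using comp peak_family_bergman(1)[OF p] by (auto simp: compact_op_def)
  moreover have "compactin little_bloch.mtopology (little_bloch.mtopology closure_of ?S)"
    using comp peak_family_bergman[OF p] by (simp add: compact_op_def norm_topology_def)
  ultimately have tb: "little_bloch.mtotally_bounded ?S"
    using little_bloch.compactin_imp_mtotally_bounded little_bloch.mtotally_bounded_closure_of_eq by blast
  have "composition_op \<phi> disk_identity \<in> little_bloch"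
    using comp disk_identity_bergman[OF p] by (auto simp: compact_op_def)
  then have \<phi>0: "(bloch_weight \<phi> \<longlongrightarrow> 0) to_unit_circle"
    by (simp add: composition_op_disk_identity[OF \<phi>] little_bloch_def)
  define c where "c = 2 + (4 / 3) powr (1 + 2 / p)"
  have c: "0 < c" by (simp add: c_def add_pos_nonneg)
  show ?thesis
  proof (rule tendstoI)
    fix \<epsilon> :: real assume \<epsilon>: "0 < \<epsilon>"
    define b where "b = \<epsilon> / (2 * c)"
    have b: "0 < b" using \<epsilon> c by (simp add: b_def)
    have "\<forall>\<^sub>F z in to_unit_circle. bloch_weight \<phi> z < b"
      using \<phi>0 b by (intro order_tendstoD) auto
    with totally_bounded_little_bloch_uniform_decay[OF tb b]
    show "\<forall>\<^sub>F z in to_unit_circle. dist (bergman_bloch_distortion p \<phi> z) 0 < \<epsilon>"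
    proof eventually_elim
      case (elim z)
      have "bergman_bloch_distortion p \<phi> z \<le> c * b"
        unfolding c_def by (rule distortion_le_peak_family[OF \<phi> p]) (use elim in auto)
      also have "\<dots> < \<epsilon>" using \<epsilon> c by (simp add: b_def)
      finally show ?case using bergman_bloch_distortion_nonneg[of z p \<phi>] elim by simp
    qed
  qed
qed

lemma vanishing_distortion_imp_compact_op:
  assumes \<phi>: "analytic_self_map \<phi>" and p: "0 < p"
    and van: "(bergman_bloch_distortion p \<phi> \<longlongrightarrow> 0) to_unit_circle"
  shows "compact_op (bergman_norm p) (bergman p) bloch_norm little_bloch (composition_op \<phi>)"
proof -
  have little: "composition_op \<phi> f \<in> little_bloch" if f: "f \<in> bergman p" for f
  proof -
    obtain K where K: "\<And>f w. f \<in> bergman p \<Longrightarrow> w \<in> unit_disk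
        \<Longrightarrow> (1 - (norm w)\<^sup>2) powr (1 + 2 / p) * norm (deriv f w) \<le> K * bergman_norm p f"
      by (rule bergman_deriv_bound[OF p]) (rule that)
    have "bergman_deriv_weight p f w \<le> K * bergman_norm p f" if "w \<in> unit_disk" for w
      unfolding bergman_deriv_weight_def by (rule K[OF f that])
    then show ?thesis
      by (rule composition_op_little_bloch_of_vanishing_distortion[OF \<phi> van bergman_imp_H_disk[OF f]])
  qed
  have "compactin little_bloch.mtopology (little_bloch.mtopology closure_of (composition_op \<phi> ` S))"
    if S: "S \<subseteq> bergman p" and bS: "norm_bounded (bergman_norm p) S" for S
  proof -
    obtain A where A: "\<And>f. f \<in> S \<Longrightarrow> bergman_norm p f \<le> A" using bS by (auto simp: norm_bounded_def)
    have sub: "composition_op \<phi> ` S \<subseteq> little_bloch" using little S by auto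
    have "\<exists>l r. l \<in> little_bloch \<and> strict_mono r \<and> limitin little_bloch.mtopology (\<sigma> \<circ> r) l sequentially"
      if \<sigma>: "range \<sigma> \<subseteq> composition_op \<phi> ` S" for \<sigma> :: "nat \<Rightarrow> complex \<Rightarrow> complex"
    proof -
      have "\<forall>n. \<exists>f\<in>S. \<sigma> n = composition_op \<phi> f" using \<sigma> by blast
      then obtain f where f: "\<And>n. f n \<in> S" "\<And>n. \<sigma> n = composition_op \<phi> (f n)" by metis
      obtain h r where "strict_mono (r :: nat \<Rightarrow> nat)"
          "limitin little_bloch.mtopology (\<lambda>n. composition_op \<phi> (f (r n))) h sequentially"
      proof (rule composition_op_subsequence_converges[OF \<phi> p van])
        show "f n \<in> bergman p" "bergman_norm p (f n) \<le> A" for n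
          using f(1)[of n] S A by auto
      qed (rule that)
      then show ?thesis
        using f(2) by (intro exI[of _ h] exI[of _ r]) (auto simp: o_def intro: little_bloch.limitin_mspace)
    qed
    then have "little_bloch \<inter> little_bloch.mtopology derived_set_of T \<noteq> {}"
      if "T \<subseteq> composition_op \<phi> ` S" "infinite T" for T
      using little_bloch.Bolzano_Weierstrass_property[OF sub sub] that by blast
    then show ?thesis
      unfolding little_bloch.compact_closure_of_eq_Bolzano_Weierstrass by blast
  qed
  then show ?thesis using little by (auto simp: compact_op_def norm_topology_def)
qed

theorem corollary4p8:
  fixes \<phi> :: "complex \<Rightarrow> complex" and p :: real
  assumes "analytic_self_map \<phi>" and "0 < p"
  shows "(bounded_op (bergman_norm p) (bergman p) bloch_norm little_bloch (composition_op \<phi>)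
           \<longleftrightarrow> bounded_op (bergman_norm p) (bergman p) bloch_norm bloch (composition_op \<phi>)
               \<and> \<phi> \<in> little_bloch)
       \<and> (compact_op (bergman_norm p) (bergman p) bloch_norm little_bloch (composition_op \<phi>)
           \<longleftrightarrow> ((\<lambda>z. (1 - (norm z)\<^sup>2) / (1 - (norm (\<phi> z))\<^sup>2) powr (1 + 2 / p) * norm (deriv \<phi> z))
                 \<longlongrightarrow> 0) to_unit_circle)"
  unfolding bergman_bloch_distortion_def[symmetric]
  using bounded_op_little_bloch_iff[OF assms] compact_op_imp_vanishing_distortion[OF assms]
    vanishing_distortion_imp_compact_op[OF assms]
  by blast

end
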